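(* For any instance $\mathcal{I}$ of $Q||C_{\min}$, the set $\mathcal{P}_{\mathrm{ass}}(\mathcal{I})$ is an upward-feasible, $2$-approximate supply polyhedron with an exact separation oracle.
   Context: An instance $\mathcal{I}$ of $Q||C_{\min}$ has a set $M$ of $m$ machines with demands $D_i>0$ and a set $J$ of $n$ job types with capacities $c_j>0$. A supply vector $s\in\mathbb{Z}^n_{\ge0}$ is feasible if the multiset with $s_j$ jobs of capacity $c_j$ can be assigned (each job to at most one machine) so that every machine $i$ gets total capacity at least $D_i$. A polyhedron $\mathcal{P}$ is an $\alpha$-approximate supply polyhedron if (a) all feasible supply vectors lie in $\mathcal{P}$ and (b) for every non-negative integer $s\in\mathcal{P}$, the $s_j$ jobs of capacity $c_j$ can be assigned so every machine $i$ gets total capacity at least $D_i/\alpha$. $\mathcal{P}$ is upward-feasible if, after ordering job types so that $c_1\le\dots\le c_n$, whenever $s\in\mathcal{P}$ and $t\in\mathbb{R}^n_{\ge0}$ satisfies $\sum_{k\ge i}t_k\ge\sum_{k\ge i}s_k$ for all $i$, also $t\in\mathcal{P}$. An exact separation oracle is a polynomial-time procedure that, given $y\in\mathbb{R}^n_{\ge0}$, either returns a hyperplane separating $y$ from $\mathcal{P}$ or asserts $y\in\mathcal{P}$. Define $\mathcal{P}_{\mathrm{ass}}(\mathcal{I})$ as the set of $s\in\mathbb{R}^n$ for which there exist $z_{ij}\ge0$ ($i\in M$, $j\in J$) with $\sum_{i\in M}z_{ij}\le s_j$ for all $j\in J$ and $\sum_{j\in J}z_{ij}\min(c_j,D_i)\ge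 D_i$ for all $i\in M$. *)

theory Defs
  imports
    Jordan_Normal_Form.Matrix
    "HOL-Combinatorics.Permutations"
    "HOL-Computational_Algebra.Polynomial"
    "HOL-Library.Log_Nat"
begin

section \<open>Instances, feasibility, supply polyhedra\<close>

text \<open>
  An instance is given by its demand vector \<open>D\<close> and its capacity vector \<open>c\<close>. The machines are
  \<open>{..<dim_vec D}\<close>, the job types are \<open>{..<dim_vec c}\<close>, and \<open>n\<close>-space is \<open>carrier_vec n\<close>.
\<close>

definition Qcmin_instance :: "real vec \<Rightarrow> real vec \<Rightarrow> bool" where
  "Qcmin_instance D c \<longleftrightarrow> (\<forall>i<dim_vec D. 0 < D $ i) \<and> (\<forall>j<dim_vec c. 0 < c $ j)"

text \<open>
  The pair \<open>(j, k)\<close> is the \<open>k\<close>-th job of type \<open>j\<close>; \<open>f (j, k) = None\<close> leaves that job unassigned.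
\<close>

definition jobs :: "nat vec \<Rightarrow> (nat \<times> nat) set" where
  "jobs s = {(j, k). j < dim_vec s \<and> k < s $ j}"

definition can_cover :: "real vec \<Rightarrow> real vec \<Rightarrow> nat vec \<Rightarrow> bool" where
  "can_cover D c s \<longleftrightarrow>
     (\<exists>f :: nat \<times> nat \<Rightarrow> nat option.
        \<forall>i<dim_vec D. D $ i \<le> (\<Sum>(j, k)\<in>{p \<in> jobs s. f p = Some i}. c $ j))"

definition is_polyhedron :: "nat \<Rightarrow> real vec set \<Rightarrow> bool" where
  "is_polyhedron n P \<longleftrightarrow>
     (\<exists>r. \<exists>A \<in> carrier_mat r n. \<exists>b \<in> carrier_vec r. P = {x \<in> carrier_vec n. A *\<^sub>v x \<le> b})"

definition approx_supply_polyhedron ::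
    "real \<Rightarrow> real vec \<Rightarrow> real vec \<Rightarrow> real vec set \<Rightarrow> bool" where
  "approx_supply_polyhedron \<alpha> D c P \<longleftrightarrow>
     is_polyhedron (dim_vec c) P \<and>
     (\<forall>s \<in> carrier_vec (dim_vec c). can_cover D c s \<longrightarrow> map_vec real s \<in> P) \<and>
     (\<forall>s \<in> carrier_vec (dim_vec c). map_vec real s \<in> P \<longrightarrow> can_cover ((1 / \<alpha>) \<cdot>\<^sub>v D) c s)"

text \<open>
  If capacities are repeated, several orderings of the job types are possible; all of them are
  required to work.
\<close>

definition upward_feasible :: "real vec \<Rightarrow> real vec set \<Rightarrow> bool" where
  "upward_feasible c P \<longleftrightarrow>
     (\<forall>\<pi>. \<pi> permutes {..<dim_vec c} \<and>
          (\<forall>k l. k \<le> l \<and> l < dim_vec c \<longrightarrow> c $ \<pi> k \<le> c $ \<pi> l) \<longrightarrow>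
        (\<forall>s \<in> P. \<forall>t \<in> carrier_vec (dim_vec c).
           0\<^sub>v (dim_vec c) \<le> t \<and>
           (\<forall>i<dim_vec c. (\<Sum>k\<in>{i..<dim_vec c}. s $ \<pi> k) \<le> (\<Sum>k\<in>{i..<dim_vec c}. t $ \<pi> k)) \<longrightarrow>
           t \<in> P))"

definition P_ass :: "real vec \<Rightarrow> real vec \<Rightarrow> real vec set" where
  "P_ass D c =
     {s \<in> carrier_vec (dim_vec c). \<exists>z :: nat \<Rightarrow> nat \<Rightarrow> real.
        (\<forall>i<dim_vec D. \<forall>j<dim_vec c. 0 \<le> z i j) \<and>
        (\<forall>j<dim_vec c. (\<Sum>i<dim_vec D. z i j) \<le> s $ j) \<and>
        (\<forall>i<dim_vec D. D $ i \<le> (\<Sum>j<dim_vec c. z i j * min (c $ j) (D $ i)))}"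


section \<open>A machine model for separation oracles\<close>

text \<open>
  Structured programs for a real random access machine. The store has index registers holding
  natural numbers and arrays of real numbers; a cell \<open>(a, r)\<close> denotes the entry of array \<open>a\<close> at
  the position held by index register \<open>r\<close>. Index registers can only be cleared, copied and
  incremented, so that their contents are bounded by the initial contents plus the running time.
  There is no rounding operation and there are no real constants except 0 and 1.
  Division by 0 yields 0.
\<close>

record store =
  idx :: "nat \<Rightarrow> nat"
  arr :: "nat \<Rightarrow> nat \<Rightarrow> real"

type_synonym cell = "nat \<times> nat"

datatype arith = Add | Sub | Mul | Div

datatype rexp = Zero | One | Get cell | Arith arith cell cell

datatype test = IdxLess nat nat | RealLess cell cell | Neg test | Conj test test

datatype com =
    Skip
  | IdxClear nat
  | IdxCopy nat nat
  | IdxIncr nat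
  | Assign cell rexp
  | Seq com com
  | Cond test com com
  | While test com

fun get :: "store \<Rightarrow> cell \<Rightarrow> real" where
  "get s (a, r) = arr s a (idx s r)"

fun put :: "cell \<Rightarrow> real \<Rightarrow> store \<Rightarrow> store" where
  "put (a, r) x s = s\<lparr>arr := (arr s)(a := (arr s a)(idx s r := x))\<rparr>"

definition set_idx :: "nat \<Rightarrow> nat \<Rightarrow> store \<Rightarrow> store" where
  "set_idx r k s = s\<lparr>idx := (idx s)(r := k)\<rparr>"

fun apply_arith :: "arith \<Rightarrow> real \<Rightarrow> real \<Rightarrow> real" where
  "apply_arith Add x y = x + y"
| "apply_arith Sub x y = x - y"
| "apply_arith Mul x y = x * y"
| "apply_arith Div x y = x / y"

fun rval :: "rexp \<Rightarrow> store \<Rightarrow> real" where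
  "rval Zero s = 0"
| "rval One s = 1"
| "rval (Get u) s = get s u"
| "rval (Arith f u v) s = apply_arith f (get s u) (get s v)"

fun holds :: "test \<Rightarrow> store \<Rightarrow> bool" where
  "holds (IdxLess q r) s \<longleftrightarrow> idx s q < idx s r"
| "holds (RealLess u v) s \<longleftrightarrow> get s u < get s v"
| "holds (Neg t) s \<longleftrightarrow> \<not> holds t s"
| "holds (Conj t t') s \<longleftrightarrow> holds t s \<and> holds t' s"

text \<open>
  The cost of a computation depends on a weight \<open>w\<close> of real numbers: every elementary operation
  costs 1 plus the weights of its real operands and of its real result. With \<open>w = (\<lambda>_. 0)\<close> this
  counts operations (uniform cost); with \<open>w\<close> the encoding length of rational numbers, it is the
  logarithmic cost, which is polynomially related to Turing machine time.
\<close>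

fun rexp_cost :: "(real \<Rightarrow> nat) \<Rightarrow> rexp \<Rightarrow> store \<Rightarrow> nat" where
  "rexp_cost w (Arith f u v) s = 1 + w (get s u) + w (get s v) + w (rval (Arith f u v) s)"
| "rexp_cost w e s = 1 + w (rval e s)"

fun test_cost :: "(real \<Rightarrow> nat) \<Rightarrow> test \<Rightarrow> store \<Rightarrow> nat" where
  "test_cost w (IdxLess q r) s = 1"
| "test_cost w (RealLess u v) s = 1 + w (get s u) + w (get s v)"
| "test_cost w (Neg t) s = 1 + test_cost w t s"
| "test_cost w (Conj t t') s = 1 + test_cost w t s + test_cost w t' s"

text \<open>
  \<open>run w p s k s'\<close>: started in store \<open>s\<close>, program \<open>p\<close> terminates in store \<open>s'\<close> at total cost \<open>k\<close>.
\<close>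

inductive run :: "(real \<Rightarrow> nat) \<Rightarrow> com \<Rightarrow> store \<Rightarrow> nat \<Rightarrow> store \<Rightarrow> bool" for w where
  Skip: "run w Skip s 1 s"
| IdxClear: "run w (IdxClear r) s 1 (set_idx r 0 s)"
| IdxCopy: "run w (IdxCopy r q) s 1 (set_idx r (idx s q) s)"
| IdxIncr: "run w (IdxIncr r) s 1 (set_idx r (Suc (idx s r)) s)"
| Assign: "run w (Assign u e) s (rexp_cost w e s) (put u (rval e s) s)"
| Seq: "run w p s k s' \<Longrightarrow> run w q s' k' s'' \<Longrightarrow> run w (Seq p q) s (k + k') s''"
| CondTrue: "holds t s \<Longrightarrow> run w p s k s' \<Longrightarrow> run w (Cond t p q) s (test_cost w t s + k) s'"
| CondFalse: "\<not> holds t s \<Longrightarrow> run w q s k s' \<Longrightarrow> run w (Cond t p q) s (test_cost w t s + k) s'"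
| WhileFalse: "\<not> holds t s \<Longrightarrow> run w (While t p) s (test_cost w t s) s"
| WhileTrue: "holds t s \<Longrightarrow> run w p s k s' \<Longrightarrow> run w (While t p) s' k' s'' \<Longrightarrow>
    run w (While t p) s (test_cost w t s + k + k') s''"

text \<open>Programs are deterministic, and the weight affects only the cost.\<close>

lemma run_deterministic:
  "run w p s k s' \<Longrightarrow> run v p s l s'' \<Longrightarrow> s'' = s' \<and> (v = w \<longrightarrow> l = k)"
proof (induction arbitrary: l s'' rule: run.induct)
  case (Seq p s k s1 q k' s2)
  from Seq.prems obtain l1 l2 r where r: "run v p s l1 r" "run v q r l2 s''" "l = l1 + l2"
    by (rule run.cases) auto
  from Seq.IH(1)[OF r(1)] have "r = s1" "v = w \<longrightarrow> l1 = k" by auto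
  with Seq.IH(2)[of l2 s''] r show ?case by simp
next
  case (CondTrue t s p k s' q)
  from CondTrue.prems CondTrue.hyps(1) obtain l' where
    "run v p s l' s''" "l = test_cost v t s + l'" by (cases rule: run.cases) auto
  with CondTrue.IH[of l' s''] show ?case by simp
next
  case (CondFalse t s q k s' p)
  from CondFalse.prems CondFalse.hyps(1) obtain l' where
    "run v q s l' s''" "l = test_cost v t s + l'" by (cases rule: run.cases) auto
  with CondFalse.IH[of l' s''] show ?case by simp
next
  case (WhileFalse t s p)
  from WhileFalse.prems WhileFalse.hyps show ?case by (cases rule: run.cases) auto
next
  case (WhileTrue t s p k s1 k' s2)
  from WhileTrue.prems WhileTrue.hyps(1) obtain l1 l2 r where
    r: "run v p s l1 r" "run v (While t p) r l2 s''" "l = test_cost v t s + l1 + l2"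
    by (cases rule: run.cases) auto
  from WhileTrue.IH(1)[OF r(1)] have "r = s1" "v = w \<longrightarrow> l1 = k" by auto
  with WhileTrue.IH(2)[of l2 s''] r show ?case by simp
qed (erule run.cases; simp)+

text \<open>
  Encoding length of a rational number in lowest terms, with one bit for the sign. The value at
  irrational numbers is unspecified and never used.
\<close>

definition bit_length :: "real \<Rightarrow> nat" where
  "bit_length x =
     (let (p, q) = quotient_of (THE r. real_of_rat r = x)
      in 1 + floorlog 2 (nat \<bar>p\<bar>) + floorlog 2 (nat q))"

definition bit_length_vec :: "real vec \<Rightarrow> nat" where
  "bit_length_vec v = (\<Sum>i<dim_vec v. bit_length (v $ i))"

definition rational_vec :: "real vec \<Rightarrow> bool" where
  "rational_vec v \<longleftrightarrow> (\<forall>i<dim_vec v. v $ i \<in> \<rat>)"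


section \<open>Separation oracles\<close>

definition array_of_vec :: "real vec \<Rightarrow> nat \<Rightarrow> real" where
  "array_of_vec v i = (if i < dim_vec v then v $ i else 0)"

definition oracle_input :: "real vec \<Rightarrow> real vec \<Rightarrow> real vec \<Rightarrow> store" where
  "oracle_input D c y =
     \<lparr>idx = (\<lambda>_. 0)(0 := dim_vec D, 1 := dim_vec c),
      arr = (\<lambda>_ _. 0)(0 := array_of_vec D, 1 := array_of_vec c, 2 := array_of_vec y)\<rparr>"

datatype answer = Member | Hyperplane "real vec" real

definition oracle_answer :: "nat \<Rightarrow> store \<Rightarrow> answer" where
  "oracle_answer n s =
     (if idx s 0 = 0 then Member else Hyperplane (vec n (arr s 0)) (arr s 1 0))"

text \<open>
  \<open>Hyperplane a b\<close> stands for the hyperplane of all \<open>x\<close> with \<open>a \<bullet> x = b\<close>. Its normal \<open>a\<close> must be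
  non-zero; only for \<open>n = 0\<close>, where there is no non-zero vector, the degenerate inequality is
  admitted.
\<close>

fun correct_answer :: "nat \<Rightarrow> real vec set \<Rightarrow> real vec \<Rightarrow> answer \<Rightarrow> bool" where
  "correct_answer n P y Member \<longleftrightarrow> y \<in> P"
| "correct_answer n P y (Hyperplane a b) \<longleftrightarrow>
     a \<in> carrier_vec n \<and> (a \<noteq> 0\<^sub>v n \<or> n = 0) \<and> a \<bullet> y < b \<and> (\<forall>x\<in>P. b \<le> a \<bullet> x)"

text \<open>
  \<open>prog\<close> is an exact separation oracle for \<open>P\<close> on the instance \<open>(D, c)\<close>, with running time bounded
  by the polynomial \<open>p\<close>: on every non-negative real \<open>y\<close> it terminates with a correct answer after
  at most \<open>p (m + n)\<close> elementary operations, where \<open>m\<close> and \<open>n\<close> are the dimensions of \<open>D\<close> and \<open>c\<close>, and if all data are rational then its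
  logarithmic cost is at most \<open>p\<close> of the encoding length of the input, so that it runs in
  polynomial time also in the bit model. A polynomial-time oracle for a family of polyhedra has
  \<open>prog\<close> and \<open>p\<close> independent of the instance.
\<close>

definition exact_separation_oracle ::
    "com \<Rightarrow> nat poly \<Rightarrow> real vec \<Rightarrow> real vec \<Rightarrow> real vec set \<Rightarrow> bool" where
  "exact_separation_oracle prog p D c P \<longleftrightarrow>
     (\<forall>y \<in> carrier_vec (dim_vec c). 0\<^sub>v (dim_vec c) \<le> y \<longrightarrow>
        (\<exists>s k. run (\<lambda>_. 0) prog (oracle_input D c y) k s \<and>
           k \<le> poly p (dim_vec D + dim_vec c) \<and>
           correct_answer (dim_vec c) P y (oracle_answer (dim_vec c) s)) \<and>
        (rational_vec D \<and> rational_vec c \<and> rational_vec y \<longrightarrow>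
           (\<exists>s k. run bit_length prog (oracle_input D c y) k s \<and>
              k \<le> poly p (dim_vec D + dim_vec c +
                          bit_length_vec D + bit_length_vec c + bit_length_vec y))))"

end

(*
  The gains min (c j) (D i) are supermodular: large jobs have a comparative advantage on large
  machines. Hence the assignment LP is solved greedily, by letting the machines in order of decreasing
  demand consume the job types in order of decreasing capacity. Along the resulting staircase, dual
  prices w i and y j are fixed by y j = w i * min (c j) (D i) at every meeting of a machine and a job
  type; if the jobs run out, these prices give a separating hyperplane. They depend only on the
  staircase, so finitely many of them describe the polyhedron, and y is monotone in c, so the
  polyhedron is upward-feasible. For integral supplies, giving each job to the machine that finishes
  it in the greedy solution loses at most half of every demand. Finally, the greedy procedure is
  strongly polynomial, and the numbers occurring in it have polynomially bounded heights.
*)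
theory Submission
  imports Defs
begin

section \<open>Greedy solution of the assignment problem\<close>

text \<open>Supermodularity enters in product form: for a smaller and a larger machine and a smaller
  and a larger job type, pairing small with small and large with large gives the greater product of
  gains. This form fits because neighbouring prices on the staircase differ by quotients of gains,
  so an inequality \<open>w k * gain k l \<le> y l\<close> can be carried over from the corner at
  which equality holds. No general duality theorem is invoked. At every stage the value of the
  supplies opened so far exceeds that of the demands opened so far by
  \<open>w i * (r * gain i j - d)\<close>. When the jobs run out this number is negative, and the
  run is its own certificate of infeasibility. Instances are plain functions here, so that the
  rounding argument can instantiate the theory a second time, with every single job as a type of its
  own with supply 1.\<close>

lemma sum_insert_update:
  fixes f :: "nat \<Rightarrow> real"
  assumes "finite A" "a \<notin> A"
  shows "(\<Sum>k\<in>insert a A. g k * (f(a := x)) k) = g a * x + (\<Sum>k\<in>A. g k * f k)"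
proof -
  have "(\<Sum>k\<in>A. g k * (f(a := x)) k) = (\<Sum>k\<in>A. g k * f k)"
    using assms by (intro sum.cong) auto
  with assms show ?thesis by simp
qed

lemma sum_increase_entry:
  fixes z :: "nat \<Rightarrow> nat \<Rightarrow> real"
  shows "i < m \<Longrightarrow> (\<Sum>k<m. (z(i := (z i)(j := z i j + x))) k j) = (\<Sum>k<m. z k j) + x"
    and "j < n \<Longrightarrow> (\<Sum>l<n. (z(i := (z i)(j := z i j + x))) i l * g l) = (\<Sum>l<n. z i l * g l) + x * g j"
  by (auto simp: sum.remove[of "{..<m}" i] sum.remove[of "{..<n}" j] algebra_simps intro!: sum.cong)

text \<open>A relation instead of a choice function: ties may be broken arbitrarily, so that the
  search of the program only has to find some maximizer.\<close>

definition greatest_on :: "(nat \<Rightarrow> real) \<Rightarrow> nat set \<Rightarrow> nat \<Rightarrow> bool" where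
  "greatest_on f S k \<longleftrightarrow> k \<in> S \<and> (\<forall>l\<in>S. f l \<le> f k)"

lemma greatest_on_exists:
  assumes "finite S" "S \<noteq> {}"
  shows "\<exists>k. greatest_on f S k"
proof -
  have "Max (f ` S) \<in> f ` S" using assms by (intro Max_in) auto
  then obtain k where "k \<in> S" "f k = Max (f ` S)" by auto
  then have "greatest_on f S k" using assms by (simp add: greatest_on_def)
  then show ?thesis ..
qed

section \<open>The assignment linear program and its dual\<close>

locale covering =
  fixes m n :: nat and D c :: "nat \<Rightarrow> real"
  assumes D_pos: "i < m \<Longrightarrow> 0 < D i"
    and c_pos: "j < n \<Longrightarrow> 0 < c j"
begin

definition gain :: "nat \<Rightarrow> nat \<Rightarrow> real" where
  "gain i j = min (c j) (D i)"

definition fractional_cover :: "(nat \<Rightarrow> real) \<Rightarrow> bool" where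
  "fractional_cover s \<longleftrightarrow> (\<exists>z :: nat \<Rightarrow> nat \<Rightarrow> real.
     (\<forall>i<m. \<forall>j<n. 0 \<le> z i j) \<and>
     (\<forall>j<n. (\<Sum>i<m. z i j) \<le> s j) \<and>
     (\<forall>i<m. D i \<le> (\<Sum>j<n. z i j * gain i j)))"

text \<open>Stronger than feasibility in the dual program: strict positivity of \<open>y\<close>
  will give a non-zero normal vector, and monotonicity in \<open>c\<close> will give upward
  feasibility.\<close>

definition dual_feasible :: "(nat \<Rightarrow> real) \<Rightarrow> (nat \<Rightarrow> real) \<Rightarrow> bool" where
  "dual_feasible w y \<longleftrightarrow>
     (\<forall>i<m. 0 \<le> w i) \<and> (\<forall>j<n. 0 < y j) \<and>
     (\<forall>i<m. \<forall>j<n. w i * gain i j \<le> y j) \<and>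
     (\<forall>j<n. \<forall>k<n. c j \<le> c k \<longrightarrow> y j \<le> y k)"

lemma weak_duality:
  assumes "fractional_cover s" "dual_feasible w y"
  shows "(\<Sum>i<m. w i * D i) \<le> (\<Sum>j<n. y j * s j)"
proof -
  obtain z where z: "\<And>i j. i < m \<Longrightarrow> j < n \<Longrightarrow> 0 \<le> z i j"
      "\<And>j. j < n \<Longrightarrow> (\<Sum>i<m. z i j) \<le> s j"
      "\<And>i. i < m \<Longrightarrow> D i \<le> (\<Sum>j<n. z i j * gain i j)"
    using assms(1) unfolding fractional_cover_def by blast
  have w: "\<And>i. i < m \<Longrightarrow> 0 \<le> w i" and y: "\<And>j. j < n \<Longrightarrow> 0 < y j"
    and wy: "\<And>i j. i < m \<Longrightarrow> j < n \<Longrightarrow> w i * gain i j \<le> y j"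
    using assms(2) unfolding dual_feasible_def by blast+
  have "(\<Sum>i<m. w i * D i) \<le> (\<Sum>i<m. w i * (\<Sum>j<n. z i j * gain i j))"
    by (intro sum_mono mult_left_mono z w) auto
  also have "\<dots> = (\<Sum>i<m. \<Sum>j<n. z i j * (w i * gain i j))"
    by (simp add: sum_distrib_left algebra_simps)
  also have "\<dots> \<le> (\<Sum>i<m. \<Sum>j<n. z i j * y j)"
    by (intro sum_mono mult_left_mono wy z) auto
  also have "\<dots> = (\<Sum>j<n. y j * (\<Sum>i<m. z i j))"
    by (subst sum.swap) (simp add: sum_distrib_left algebra_simps)
  also have "\<dots> \<le> (\<Sum>j<n. y j * s j)"
    by (intro sum_mono mult_left_mono z less_imp_le[OF y]) auto
  finally show ?thesis .
qed

lemma fractional_cover_mono: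
  assumes "fractional_cover s" "\<And>j. j < n \<Longrightarrow> s j \<le> t j"
  shows "fractional_cover t"
proof -
  obtain z :: "nat \<Rightarrow> nat \<Rightarrow> real" where z: "\<forall>i<m. \<forall>j<n. 0 \<le> z i j"
    "\<forall>j<n. (\<Sum>i<m. z i j) \<le> s j" "\<forall>i<m. D i \<le> (\<Sum>j<n. z i j * gain i j)"
    using assms(1) unfolding fractional_cover_def by blast
  have "(\<Sum>i<m. z i j) \<le> t j" if "j < n" for j
    using order_trans[OF z(2)[rule_format, OF that] assms(2)[OF that]] .
  with z(1,3) show ?thesis unfolding fractional_cover_def by blast
qed

section \<open>The greedy staircase and its invariants\<close>

lemma gain_pos: "i < m \<Longrightarrow> j < n \<Longrightarrow> 0 < gain i j"
  using D_pos c_pos by (simp add: gain_def)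

lemma gain_le: "gain i j \<le> D i" "gain i j \<le> c j"
  by (simp_all add: gain_def)

lemma gain_mono: "c j \<le> c k \<Longrightarrow> gain i j \<le> gain i k"
  by (simp add: gain_def)

text \<open>If \<open>c j \<le> D i\<close>, the smaller job type has the same gain on both
  machines, and a larger machine gains no less from \<open>l\<close>. Otherwise the smaller machine
  gains \<open>D i\<close> from both types, and a larger type gives no less to
  \<open>k\<close>.\<close>

lemma gain_supermodular:
  assumes "i < m" "k < m" "j < n" "l < n" "D i \<le> D k" "c j \<le> c l"
  shows "gain i l * gain k j \<le> gain i j * gain k l"
proof (cases "c j \<le> D i")
  case True
  then have "gain i j = c j" "gain k j = c j" "gain i l \<le> gain k l"
    using assms by (auto simp: gain_def)
  then show ?thesis
    using c_pos[OF assms(3)] by (simp add: mult.commute mult_left_mono)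
next
  case False
  then have "gain i j = D i" "gain i l = D i" "gain k j \<le> gain k l"
    using assms by (auto simp: gain_def)
  then show ?thesis
    using D_pos[OF assms(1)] by (simp add: mult_left_mono)
qed

text \<open>
  In a state \<open>greedy s U i V j w y r d\<close> the machines \<open>U\<close> are satisfied and the job types \<open>V\<close> used up;
  machine \<open>i\<close> still needs \<open>d\<close>, and \<open>r\<close> jobs of type \<open>j\<close> are left. The prices \<open>w\<close>, \<open>y\<close> are
  chosen such that \<open>y j = w i * gain i j\<close> whenever \<open>i\<close> and \<open>j\<close> meet.
\<close>

inductive greedy ::
    "(nat \<Rightarrow> real) \<Rightarrow> nat set \<Rightarrow> nat \<Rightarrow> nat set \<Rightarrow> nat \<Rightarrow> (nat \<Rightarrow> real) \<Rightarrow> (nat \<Rightarrow> real) \<Rightarrow>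
     real \<Rightarrow> real \<Rightarrow> bool"
  for s where
  start: "greatest_on D {..<m} i \<Longrightarrow> greatest_on c {..<n} j \<Longrightarrow>
    greedy s {} i {} j ((\<lambda>_. 0)(i := 1)) ((\<lambda>_. 0)(j := gain i j)) (s j) (D i)"
| next_job: "greedy s U i V j w y r d \<Longrightarrow> r * gain i j < d \<Longrightarrow>
    greatest_on c ({..<n} - insert j V) l \<Longrightarrow>
    greedy s U i (insert j V) l w (y(l := w i * gain i l)) (s l) (d - r * gain i j)"
| next_machine: "greedy s U i V j w y r d \<Longrightarrow> d \<le> r * gain i j \<Longrightarrow>
    greatest_on D ({..<m} - insert i U) k \<Longrightarrow>
    greedy s (insert i U) k V j (w(k := w i * gain i j / gain k j)) y
      (r - d / gain i j) (D k)"

lemma greedy_sorted: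
  assumes "greedy s U i V j w y r d"
  shows "U \<subseteq> {..<m} \<and> i < m \<and> i \<notin> U \<and> V \<subseteq> {..<n} \<and> j < n \<and> j \<notin> V \<and>
    (\<forall>k\<in>U. D i \<le> D k) \<and> (\<forall>k\<in>{..<m} - U. D k \<le> D i) \<and>
    (\<forall>l\<in>V. c j \<le> c l) \<and> (\<forall>l\<in>{..<n} - V. c l \<le> c j)"
  using assms
proof (induction rule: greedy.induct)
  case (next_job U i V j w y r d l)
  then have "l < n" "l \<notin> V" "c l \<le> c j" by (auto simp: greatest_on_def)
  moreover have "\<forall>l'\<in>{..<n} - insert j V. c l' \<le> c l"
    using next_job.hyps(3) by (simp add: greatest_on_def)
  ultimately show ?case using next_job.IH next_job.hyps(3)
    by (intro conjI) (auto simp: greatest_on_def intro: order_trans)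
next
  case (next_machine U i V j w y r d k)
  then have k: "k < m" "k \<notin> U" "D k \<le> D i" by (auto simp: greatest_on_def)
  moreover have "\<forall>k'\<in>{..<m} - insert i U. D k' \<le> D k"
    using next_machine.hyps(3) by (simp add: greatest_on_def)
  ultimately show ?case using next_machine.IH next_machine.hyps(3)
    by (intro conjI) (auto simp: greatest_on_def intro: order_trans)
qed (auto simp: greatest_on_def)

lemma greedy_finite:
  assumes "greedy s U i V j w y r d"
  shows "finite U" "finite V"
  using greedy_sorted[OF assms] finite_subset[OF _ finite_lessThan] by blast+

text \<open>The strict test in \<open>next_job\<close> keeps \<open>d\<close> positive. A tie counts
  as a satisfied machine and leaves nothing of the job type, so \<open>r\<close> may become
  0.\<close>

lemma greedy_pos:
  assumes "greedy s U i V j w y r d" "\<And>j. j < n \<Longrightarrow> 0 \<le> s j"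
  shows "0 \<le> r \<and> 0 < d"
  using assms
proof (induction rule: greedy.induct)
  case (next_machine U i V j w y r d k)
  have "i < m" "j < n" using greedy_sorted[OF next_machine.hyps(1)] by auto
  then have "d / gain i j \<le> r" using next_machine.hyps gain_pos[of i j]
    by (simp add: divide_le_eq)
  with next_machine show ?case using D_pos by (auto simp: greatest_on_def)
qed (auto simp: greatest_on_def D_pos)

text \<open>For a new job type \<open>l\<close>, the old type \<open>j\<close> mediates:
  \<open>w k * gain k j \<le> w i * gain i j\<close>, and passing from \<open>j\<close> to the
  smaller \<open>l\<close> can only favour the smallest machine \<open>i\<close>. A new machine is
  treated dually. The witness clause says that each \<open>y l\<close> is a maximum that is
  attained, from which positivity and monotonicity of \<open>y\<close> follow later.\<close>

lemma greedy_dual: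
  assumes "greedy s U i V j w y r d"
  shows "(\<forall>k\<in>insert i U. 0 < w k) \<and> (\<forall>k. k \<notin> insert i U \<longrightarrow> w k = 0) \<and>
    y j = w i * gain i j \<and>
    (\<forall>l\<in>insert j V. (\<forall>k\<in>insert i U. w k * gain k l \<le> y l) \<and>
       (\<exists>k\<in>insert i U. y l = w k * gain k l))"
  using assms
proof (induction rule: greedy.induct)
  case (start i j)
  then show ?case by auto
next
  case (next_job U i V j w y r d l)
  note s = greedy_sorted[OF next_job.hyps(1)]
  have l: "l < n" "l \<noteq> j" "l \<notin> V" "c l \<le> c j"
    using next_job.hyps(3) s by (auto simp: greatest_on_def)
  have new: "w k * gain k l \<le> w i * gain i l" if k: "k \<in> insert i U" for k
  proof -
    have k': "k < m" "D i \<le> D k" using k s by auto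
    \<comment> \<open>Quotients are avoided by comparing after multiplication with the positive
      \<open>gain i j\<close>, which is cancelled at the end.\<close>
    have "(w k * gain k l) * gain i j \<le> w k * (gain i l * gain k j)"
    proof -
      have "gain i j * gain k l \<le> gain i l * gain k j"
        using gain_supermodular[of i k l j] s k' l by auto
      moreover have "0 < w k" using next_job.IH k by auto
      ultimately show ?thesis by (metis mult.assoc mult.commute mult_left_mono less_imp_le)
    qed
    also have "\<dots> = (w k * gain k j) * gain i l" by simp
    also have "\<dots> \<le> (w i * gain i j) * gain i l"
      using next_job.IH k gain_pos[of i l] s l by (intro mult_right_mono) auto
    finally have "(w k * gain k l) * gain i j \<le> (w i * gain i l) * gain i j"
      by (simp add: ac_simps)
    then show ?thesis using gain_pos[of i j] s by auto
  qed
  have old: "(y(l := w i * gain i l)) l' = y l'" if "l' \<in> insert j V" for l'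
    using l that by auto
  show ?case
  proof (intro conjI ballI allI impI)
    show "(y(l := w i * gain i l)) l = w i * gain i l" by simp
    show "w k * gain k l' \<le> (y(l := w i * gain i l)) l'"
      if "l' \<in> insert l (insert j V)" "k \<in> insert i U" for k l'
      using that new next_job.IH by auto
    show "\<exists>k\<in>insert i U. (y(l := w i * gain i l)) l' = w k * gain k l'"
      if "l' \<in> insert l (insert j V)" for l'
      using next_job.IH that old by (metis fun_upd_same insertCI insertE)
  qed (use next_job.IH in auto)
next
  case (next_machine U i V j w y r d k)
  note s = greedy_sorted[OF next_machine.hyps(1)]
  have k: "k < m" "k \<noteq> i" "k \<notin> U" "D k \<le> D i"
    using next_machine.hyps(3) s by (auto simp: greatest_on_def)
  have pos: "0 < gain k j" "0 < gain i j" using k s gain_pos by auto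
  define wk where "wk = w i * gain i j / gain k j"
  have wk: "wk * gain k j = w i * gain i j" "0 < wk"
    using pos next_machine.IH by (auto simp: wk_def)
  have new: "wk * gain k l \<le> y l" if l: "l \<in> insert j V" for l
  proof -
    have l': "l < n" "c j \<le> c l" using l s by auto
    have "(wk * gain k l) * gain k j = w i * (gain i j * gain k l)"
      using wk(1) by (metis mult.assoc mult.commute)
    also have "\<dots> \<le> w i * (gain k j * gain i l)"
      using gain_supermodular[of k i j l] s k l' next_machine.IH
      by (intro mult_left_mono) (auto simp: ac_simps)
    also have "\<dots> = (w i * gain i l) * gain k j" by simp
    also have "\<dots> \<le> y l * gain k j"
      using next_machine.IH l pos by (intro mult_right_mono) auto
    finally show ?thesis using pos by auto
  qed
  have old: "(w(k := wk)) k' = w k'" if "k' \<in> insert i U" for k'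
    using k that by auto
  show ?case
    unfolding wk_def[symmetric]
  proof (intro conjI ballI allI impI)
    show "0 < (w(k := wk)) k'" if "k' \<in> insert k (insert i U)" for k'
      using that wk(2) next_machine.IH by auto
    show "(w(k := wk)) k' = 0" if "k' \<notin> insert k (insert i U)" for k'
      using that next_machine.IH by auto
    show "y j = (w(k := wk)) k * gain k j"
      using wk(1) next_machine.IH by simp
    show "(w(k := wk)) k' * gain k' l \<le> y l"
      if "l \<in> insert j V" "k' \<in> insert k (insert i U)" for k' l
      using that new[of l] next_machine.IH by auto
    show "\<exists>k'\<in>insert k (insert i U). y l = (w(k := wk)) k' * gain k' l"
      if "l \<in> insert j V" for l
      using next_machine.IH that old by (metis insertCI)
  qed
qed

text \<open>Where a machine and a type meet, \<open>y j = w i * gain i j\<close>, so consumed supply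
  and satisfied demand have equal value. What remains is the leftover of the current type minus the
  open demand of the current machine.\<close>

lemma greedy_gap:
  assumes "greedy s U i V j w y r d"
  shows "(\<Sum>l\<in>insert j V. s l * y l) - (\<Sum>k\<in>insert i U. D k * w k) = r * y j - d * w i"
  using assms
proof (induction rule: greedy.induct)
  case (next_job U i V j w y r d l)
  note fin = greedy_finite[OF next_job.hyps(1)]
  have l: "l \<notin> insert j V"
    using next_job.hyps(3) by (auto simp: greatest_on_def)
  have "y j = w i * gain i j" using greedy_dual[OF next_job.hyps(1)] by simp
  then show ?case
    using sum_insert_update[of "insert j V" l s y] l fin next_job.IH
    by (simp add: algebra_simps)
next
  case (next_machine U i V j w y r d k)
  note s = greedy_sorted[OF next_machine.hyps(1)] and fin = greedy_finite[OF next_machine.hyps(1)]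
  have k: "k \<notin> insert i U" "k < m"
    using next_machine.hyps(3) by (auto simp: greatest_on_def)
  have "y j = w i * gain i j" "0 < gain i j"
    using greedy_dual[OF next_machine.hyps(1)] gain_pos s by auto
  then show ?case
    using sum_insert_update[of "insert i U" k D w] k fin next_machine.IH
    by (simp add: algebra_simps)
qed simp

text \<open>The state keeps only leftovers; the allocation is rebuilt here by increasing one entry
  per move. As all entries outside the opened rows and columns are 0, a newly opened row or column
  starts with sum 0.\<close>

lemma greedy_primal:
  assumes "greedy s U i V j w y r d" "\<And>j. j < n \<Longrightarrow> 0 \<le> s j"
  shows "\<exists>z :: nat \<Rightarrow> nat \<Rightarrow> real.
    (\<forall>k l. 0 \<le> z k l) \<and> (\<forall>k l. k \<notin> insert i U \<or> l \<notin> insert j V \<longrightarrow> z k l = 0) \<and>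
    (\<forall>l\<in>V. (\<Sum>k<m. z k l) \<le> s l) \<and> (\<Sum>k<m. z k j) = s j - r \<and>
    (\<forall>k\<in>U. D k \<le> (\<Sum>l<n. z k l * gain k l)) \<and> (\<Sum>l<n. z i l * gain i l) = D i - d"
  using assms
proof (induction rule: greedy.induct)
  case (start i j)
  then show ?case by (intro exI[of _ "\<lambda>_ _. 0"]) auto
next
  case (next_job U i V j w y r d l)
  note s = greedy_sorted[OF next_job.hyps(1)]
  have r: "0 \<le> r" using greedy_pos[OF next_job.hyps(1)] next_job.prems by auto
  have l: "l \<notin> insert j V" "l < n"
    using next_job.hyps(3) by (auto simp: greatest_on_def)
  obtain z where z: "\<And>k l. 0 \<le> z k l" "\<And>k l. k \<notin> insert i U \<or> l \<notin> insert j V \<Longrightarrow> z k l = 0"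
     "\<And>l. l \<in> V \<Longrightarrow> (\<Sum>k<m. z k l) \<le> s l" "(\<Sum>k<m. z k j) = s j - r"
     "\<And>k. k \<in> U \<Longrightarrow> D k \<le> (\<Sum>l<n. z k l * gain k l)" "(\<Sum>l<n. z i l * gain i l) = D i - d"
    using next_job.IH next_job.prems by blast
  define z' where "z' = z(i := (z i)(j := z i j + r))"
  have col: "(\<Sum>k<m. z' k j) = (\<Sum>k<m. z k j) + r"
    and row: "(\<Sum>l<n. z' i l * gain i l) = (\<Sum>l<n. z i l * gain i l) + r * gain i j"
    unfolding z'_def by (rule sum_increase_entry, use s in simp)+
  have z'_other: "z' k l' = z k l'" if "k \<noteq> i \<or> l' \<noteq> j" for k l'
    using that by (auto simp: z'_def)
  show ?case
  proof (intro exI[of _ z'] conjI allI ballI impI)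
    show "0 \<le> z' k l'" for k l' using z(1) r by (auto simp: z'_def)
    show "z' k l' = 0" if "k \<notin> insert i U \<or> l' \<notin> insert l (insert j V)" for k l'
      using that z(2)[of k l'] by (auto simp: z'_def)
    show "(\<Sum>k<m. z' k l') \<le> s l'" if "l' \<in> insert j V" for l'
    proof (cases "l' = j")
      case False
      then show ?thesis using z(3)[of l'] that by (simp add: z'_other)
    qed (simp add: col z)
    show "(\<Sum>k<m. z' k l) = s l - s l"
    proof -
      have "z' k l = 0" for k using l z(2)[of k l] z'_other[of k l] by auto
      then show ?thesis by simp
    qed
    show "D k \<le> (\<Sum>l<n. z' k l * gain k l)" if "k \<in> U" for k
      using z(5)[OF that] that s z'_other by (metis (no_types, lifting) sum.cong)
    show "(\<Sum>l<n. z' i l * gain i l) = D i - (d - r * gain i j)"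
      using row z by simp
  qed
next
  case (next_machine U i V j w y r d h)
  note s = greedy_sorted[OF next_machine.hyps(1)]
  have d: "0 < d" using greedy_pos[OF next_machine.hyps(1)] next_machine.prems by auto
  have h: "h \<notin> insert i U" "h < m"
    using next_machine.hyps(3) by (auto simp: greatest_on_def)
  have g: "0 < gain i j" using s gain_pos by auto
  obtain z where z: "\<And>k l. 0 \<le> z k l" "\<And>k l. k \<notin> insert i U \<or> l \<notin> insert j V \<Longrightarrow> z k l = 0"
     "\<And>l. l \<in> V \<Longrightarrow> (\<Sum>k<m. z k l) \<le> s l" "(\<Sum>k<m. z k j) = s j - r"
     "\<And>k. k \<in> U \<Longrightarrow> D k \<le> (\<Sum>l<n. z k l * gain k l)" "(\<Sum>l<n. z i l * gain i l) = D i - d"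
    using next_machine.IH next_machine.prems by blast
  define x where "x = d / gain i j"
  have x: "0 \<le> x" "x * gain i j = d" using d g by (auto simp: x_def)
  define z' where "z' = z(i := (z i)(j := z i j + x))"
  have col: "(\<Sum>k<m. z' k j) = (\<Sum>k<m. z k j) + x"
    and row: "(\<Sum>l<n. z' i l * gain i l) = (\<Sum>l<n. z i l * gain i l) + x * gain i j"
    unfolding z'_def by (rule sum_increase_entry, use s in simp)+
  have z'_other: "z' k l' = z k l'" if "k \<noteq> i \<or> l' \<noteq> j" for k l'
    using that by (auto simp: z'_def)
  show ?case unfolding x_def[symmetric]
  proof (intro exI[of _ z'] conjI allI ballI impI)
    show "0 \<le> z' k l'" for k l' using z(1) x by (auto simp: z'_def)
    show "z' k l' = 0" if "k \<notin> insert h (insert i U) \<or> l' \<notin> insert j V" for k l'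
      using that z(2)[of k l'] by (auto simp: z'_def)
    show "(\<Sum>k<m. z' k l') \<le> s l'" if "l' \<in> V" for l'
      using z(3)[of l'] that s z'_other by (metis (no_types, lifting) sum.cong)
    show "(\<Sum>k<m. z' k j) = s j - (r - x)"
      using col z by simp
    show "D k \<le> (\<Sum>l<n. z' k l * gain k l)" if "k \<in> insert i U" for k
    proof (cases "k = i")
      case False
      then show ?thesis using z(5)[of k] that by (simp add: z'_other)
    qed (simp add: row z x)
    show "(\<Sum>l<n. z' h l * gain h l) = D h - D h"
    proof -
      have "z' h l = 0" for l using h z(2)[of h l] z'_other[of h l] by auto
      then show ?thesis by simp
    qed
  qed
qed

lemma greedy_success:
  assumes "greedy s U i V j w y r d" "\<And>j. j < n \<Longrightarrow> 0 \<le> s j"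
    and "d \<le> r * gain i j" "{..<m} \<subseteq> insert i U"
  shows "fractional_cover s"
proof -
  note sorted = greedy_sorted[OF assms(1)]
  obtain z where z: "\<And>k l. 0 \<le> z k l" "\<And>k l. k \<notin> insert i U \<or> l \<notin> insert j V \<Longrightarrow> z k l = 0"
     "\<And>l. l \<in> V \<Longrightarrow> (\<Sum>k<m. z k l) \<le> s l" "(\<Sum>k<m. z k j) = s j - r"
     "\<And>k. k \<in> U \<Longrightarrow> D k \<le> (\<Sum>l<n. z k l * gain k l)" "(\<Sum>l<n. z i l * gain i l) = D i - d"
    using greedy_primal[OF assms(1,2)] by blast
  have r: "0 \<le> r" using greedy_pos[OF assms(1,2)] by simp
  \<comment> \<open>The last machine may take everything that is left of \<open>j\<close>: exceeding
    its demand is harmless.\<close>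
  define z' where "z' = z(i := (z i)(j := z i j + r))"
  have z'_other: "z' k l = z k l" if "k \<noteq> i \<or> l \<noteq> j" for k l
    using that by (auto simp: z'_def)
  have col: "(\<Sum>k<m. z' k j) = (\<Sum>k<m. z k j) + r"
    and row: "(\<Sum>l<n. z' i l * gain i l) = (\<Sum>l<n. z i l * gain i l) + r * gain i j"
    unfolding z'_def by (rule sum_increase_entry, use sorted in simp)+
  show ?thesis unfolding fractional_cover_def
  proof (intro exI[of _ z'] conjI allI impI)
    show "0 \<le> z' k l" for k l using z(1) r by (auto simp: z'_def)
    show "(\<Sum>k<m. z' k l) \<le> s l" if "l < n" for l
    proof (cases "l = j")
      case False
      then have "(\<Sum>k<m. z' k l) = (\<Sum>k<m. z k l)" by (simp add: z'_other)
      also have "\<dots> \<le> s l"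
      proof (cases "l \<in> V")
        case False
        then have "\<And>k. z k l = 0" using z(2) \<open>l \<noteq> j\<close> by auto
        then show ?thesis using assms(2)[OF that] by simp
      qed (rule z(3))
      finally show ?thesis .
    qed (simp add: col z)
    show "D k \<le> (\<Sum>l<n. z' k l * gain k l)" if "k < m" for k
    proof (cases "k = i")
      case False
      then have "k \<in> U" using assms(4) that by auto
      then show ?thesis using z(5)[of k] False by (simp add: z'_other)
    qed (use row z(6) assms(3) in simp)
  qed
qed

text \<open>The gap is \<open>w i * (r * gain i j - d)\<close>, which is negative. Machines that
  were never reached have price 0, so they violate no dual constraint and add nothing to the dual
  objective.\<close>

lemma greedy_failure:
  assumes "greedy s U i V j w y r d" "r * gain i j < d" "{..<n} \<subseteq> insert j V"
  shows "dual_feasible w y" "(\<Sum>j<n. y j * s j) < (\<Sum>k\<in>insert i U. w k * D k)"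
    "(\<Sum>k\<in>insert i U. w k * D k) = (\<Sum>k<m. w k * D k)"
proof -
  note sorted = greedy_sorted[OF assms(1)] and dual = greedy_dual[OF assms(1)]
  have V: "insert j V = {..<n}" using assms(3) sorted by auto
  have U: "insert i U \<subseteq> {..<m}" using sorted by auto
  have w: "0 \<le> w k" for k using dual by (cases "k \<in> insert i U") (auto intro: less_imp_le)
  have y: "\<exists>k\<in>insert i U. y l = w k * gain k l" if "l < n" for l
    using dual V that by blast
  have wy: "w k * gain k l \<le> y l" if "k \<in> insert i U" "l < n" for k l
    using dual V that by blast
  show "dual_feasible w y" unfolding dual_feasible_def
  proof (intro conjI allI impI)
    show pos: "0 < y l" if l: "l < n" for l
    proof -
      obtain k where "k \<in> insert i U" "y l = w k * gain k l" using y[OF l] by blast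
      then show ?thesis using dual U gain_pos[of k l] l by auto
    qed
    show "w k * gain k l \<le> y l" if "k < m" "l < n" for k l
      using wy[of k l] dual that pos[of l] by (cases "k \<in> insert i U") auto
    show "y l \<le> y l'" if l: "l < n" "l' < n" "c l \<le> c l'" for l l'
    proof -
      obtain k where k: "k \<in> insert i U" "y l = w k * gain k l" using y[OF l(1)] by blast
      have "w k * gain k l \<le> w k * gain k l'" using gain_mono[OF l(3)] w by (rule mult_left_mono)
      then show ?thesis using k wy[of k l'] l by simp
    qed
  qed (rule w)
  have "w i > 0" "y j = w i * gain i j" using dual by auto
  then have "r * y j - d * w i < 0" using assms(2)
    by (metis diff_less_0_iff_less mult.assoc mult.commute mult_strict_right_mono)
  then show "(\<Sum>j<n. y j * s j) < (\<Sum>k\<in>insert i U. w k * D k)"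
    using greedy_gap[OF assms(1)] by (simp only: V mult.commute)
  show "(\<Sum>k\<in>insert i U. w k * D k) = (\<Sum>k<m. w k * D k)"
    using U dual by (intro sum.mono_neutral_left) auto
qed

lemma greedy_terminates:
  assumes "greedy s U i V j w y r d"
  shows "\<exists>U i V j w y r d. greedy s U i V j w y r d \<and>
    (d \<le> r * gain i j \<and> {..<m} \<subseteq> insert i U \<or> r * gain i j < d \<and> {..<n} \<subseteq> insert j V)"
  using assms
proof (induction "card ({..<m} - U) + card ({..<n} - V)" arbitrary: U i V j w y r d rule: less_induct)
  case less
  note sorted = greedy_sorted[OF less.prems]
  show ?case
  proof (cases "r * gain i j < d")
    case True
    show ?thesis
    proof (cases "{..<n} \<subseteq> insert j V")
      case False
      then obtain l where l: "greatest_on c ({..<n} - insert j V) l"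
        using greatest_on_exists[of "{..<n} - insert j V"] by auto
      have "card ({..<n} - insert j V) < card ({..<n} - V)"
        using sorted by (intro psubset_card_mono) auto
      then show ?thesis using less.hyps[OF _ next_job[OF less.prems True l]] by simp
    qed (use less.prems True in blast)
  next
    case False
    show ?thesis
    proof (cases "{..<m} \<subseteq> insert i U")
      case notall: False
      then obtain k where k: "greatest_on D ({..<m} - insert i U) k"
        using greatest_on_exists[of "{..<m} - insert i U"] by auto
      have "card ({..<m} - insert i U) < card ({..<m} - U)"
        using sorted by (intro psubset_card_mono) auto
      then show ?thesis using less.hyps[OF _ next_machine[OF less.prems _ k]] False by simp
    qed (use less.prems False in \<open>meson not_less\<close>)
  qed
qed

lemma greedy_initial:
  assumes "0 < m" "0 < n"
  shows "\<exists>i j w y. greedy s {} i {} j w y (s j) (D i)"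
proof -
  obtain i j where "greatest_on D {..<m} i" "greatest_on c {..<n} j"
    using greatest_on_exists[of "{..<m}"] greatest_on_exists[of "{..<n}"] assms by fastforce
  then show ?thesis using greedy.start by blast
qed

section \<open>Finitely many prices, and the consequences of duality\<close>

definition greedy_prices :: "((nat \<Rightarrow> real) \<times> (nat \<Rightarrow> real)) set" where
  "greedy_prices = {(w, y). \<exists>s U i V j r d. greedy s U i V j w y r d}"

text \<open>Once \<open>s\<close>, \<open>r\<close> and \<open>d\<close> are forgotten, a move is
  determined by its kind and by the index of the new machine or type. Each state thus has at most
  \<open>m + n\<close> successors, and each machine and type is used at most once, so runs have
  bounded length.\<close>

lemma finite_greedy_prices: "finite greedy_prices"
proof -
  \<comment> \<open>The states after \<open>e\<close> moves, for all supplies at once.\<close>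
  define R where "R e = {(U, i, V, j, w, y). card U + card V = e \<and>
    (\<exists>s r d. greedy s U i V j w y r d)}" for e
  define job where
    "job = (\<lambda>((U :: nat set, i, V, j :: nat, w, y), l). (U, i, insert j V, l, w, y(l := w i * gain i l)))"
  define mach where
    "mach = (\<lambda>((U, i, V :: nat set, j, w, y), k).
      (insert i U, k, V, j, w(k := w i * gain i j / gain k j), y :: nat \<Rightarrow> real))"
  have fin: "finite (R e)" for e
  proof (induction e)
    case 0
    have "R 0 \<subseteq> (\<lambda>(i, j). ({}, i, {}, j, (\<lambda>_. 0)(i := 1), (\<lambda>_. 0)(j := gain i j))) ` ({..<m} \<times> {..<n})"
    proof
      fix x assume "x \<in> R 0"
      then obtain U i V j w y s r d where x: "x = (U, i, V, j, w, y)"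
        and g: "greedy s U i V j w y r d" and "card U + card V = 0"
        by (auto simp: R_def)
      then have "U = {}" "V = {}" using greedy_finite[OF g] by auto
      with g x greedy_sorted[OF g] show
        "x \<in> (\<lambda>(i, j). ({}, i, {}, j, (\<lambda>_. 0)(i := 1), (\<lambda>_. 0)(j := gain i j))) ` ({..<m} \<times> {..<n})"
        by (cases rule: greedy.cases) (auto simp: image_iff)
    qed
    then show ?case by (rule finite_subset) simp
  next
    case (Suc e)
    have "R (Suc e) \<subseteq> job ` (R e \<times> {..<n}) \<union> mach ` (R e \<times> {..<m})"
    proof
      fix x assume "x \<in> R (Suc e)"
      then obtain U i V j w y s r d where x: "x = (U, i, V, j, w, y)"
        and g: "greedy s U i V j w y r d" and card: "card U + card V = Suc e"
        by (auto simp: R_def)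
      from g show "x \<in> job ` (R e \<times> {..<n}) \<union> mach ` (R e \<times> {..<m})"
      proof (cases rule: greedy.cases)
        case start
        then show ?thesis using card by simp
      next
        case (next_job V' j' y' r' d')
        have "(U, i, V', j', w, y') \<in> R e"
          using next_job card greedy_sorted[OF next_job(5)] greedy_finite[OF next_job(5)]
          by (auto simp: R_def)
        moreover have "j < n" using greedy_sorted[OF g] by simp
        moreover have "x = job ((U, i, V', j', w, y'), j)"
          using x next_job by (simp add: job_def)
        ultimately show ?thesis by blast
      next
        case (next_machine U' i' w' r' d')
        have "(U', i', V, j, w', y) \<in> R e"
          using next_machine card greedy_sorted[OF next_machine(5)] greedy_finite[OF next_machine(5)]
          by (auto simp: R_def)
        moreover have "i < m" using greedy_sorted[OF g] by simp
        moreover have "x = mach ((U', i', V, j, w', y), i)"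
          using x next_machine by (simp add: mach_def)
        ultimately show ?thesis by blast
      qed
    qed
    then show ?case by (rule finite_subset) (use Suc in simp)
  qed
  have "greedy_prices \<subseteq> (\<lambda>(U, i, V, j, w, y). (w, y)) ` (\<Union>e\<le>m + n. R e)"
  proof
    fix x assume "x \<in> greedy_prices"
    then obtain w y s U i V j r d where x: "x = (w, y)" and g: "greedy s U i V j w y r d"
      by (auto simp: greedy_prices_def)
    have "card U \<le> m" "card V \<le> n"
      using greedy_sorted[OF g] card_mono[of "{..<m}" U] card_mono[of "{..<n}" V] by auto
    then have "(U, i, V, j, w, y) \<in> (\<Union>e\<le>m + n. R e)"
      using g by (auto simp: R_def)
    then show "x \<in> (\<lambda>(U, i, V, j, w, y). (w, y)) ` (\<Union>e\<le>m + n. R e)"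
      using x by (force simp: image_iff)
  qed
  then show ?thesis by (rule finite_subset) (use fin in simp)
qed

text \<open>For \<open>n = 0\<close> the greedy procedure does not start; then \<open>(1, 1)\<close> certifies infeasibility.\<close>

definition prices :: "((nat \<Rightarrow> real) \<times> (nat \<Rightarrow> real)) set" where
  "prices = {(w, y) \<in> insert (\<lambda>_. 1, \<lambda>_. 1) greedy_prices. dual_feasible w y}"

lemma finite_prices: "finite prices"
  unfolding prices_def using finite_greedy_prices
  by (rule finite_subset[rotated, OF finite.insertI]) auto

lemma strong_duality:
  assumes "\<And>j. j < n \<Longrightarrow> 0 \<le> s j" "\<not> fractional_cover s"
  shows "\<exists>(w, y)\<in>prices. (\<Sum>j<n. y j * s j) < (\<Sum>i<m. w i * D i)"
proof -
  have m: "0 < m"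
  proof (rule ccontr)
    assume "\<not> 0 < m"
    then have "fractional_cover s"
      using assms(1) unfolding fractional_cover_def by simp
    with assms(2) show False ..
  qed
  show ?thesis
  proof (cases "n = 0")
    case True
    have "0 < (\<Sum>i<m. D i)" using m D_pos by (intro sum_pos) auto
    moreover have "(\<lambda>_. 1, \<lambda>_. 1) \<in> prices"
      unfolding prices_def dual_feasible_def using True by simp
    ultimately show ?thesis
      by (intro bexI[of _ "(\<lambda>_. 1, \<lambda>_. 1)"]) (simp_all add: True)
  next
    case False
    obtain U i V j w y r d where g: "greedy s U i V j w y r d"
      "d \<le> r * gain i j \<and> {..<m} \<subseteq> insert i U \<or> r * gain i j < d \<and> {..<n} \<subseteq> insert j V"
      using greedy_initial[of s] m False greedy_terminates[of s] by (metis neq0_conv)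
    with greedy_success[OF g(1)] assms have fail: "r * gain i j < d" "{..<n} \<subseteq> insert j V" by auto
    have "(w, y) \<in> prices"
      using g(1) greedy_failure(1)[OF g(1) fail] by (auto simp: prices_def greedy_prices_def)
    then show ?thesis using greedy_failure(2,3)[OF g(1) fail] by (intro bexI) auto
  qed
qed

text \<open>A finite system of linear inequalities. The signs of \<open>s\<close> are listed
  separately because certificates are constructed only for non-negative supplies.\<close>

lemma fractional_cover_iff:
  "fractional_cover s \<longleftrightarrow>
     (\<forall>j<n. 0 \<le> s j) \<and> (\<forall>(w, y)\<in>prices. (\<Sum>i<m. w i * D i) \<le> (\<Sum>j<n. y j * s j))"
proof (intro iffI conjI)
  assume f: "fractional_cover s"
  then show "\<forall>j<n. 0 \<le> s j"
    unfolding fractional_cover_def by (meson lessThan_iff order_trans sum_nonneg)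
  show "\<forall>(w, y)\<in>prices. (\<Sum>i<m. w i * D i) \<le> (\<Sum>j<n. y j * s j)"
    using weak_duality[OF f] by (auto simp: prices_def)
qed (use strong_duality[of s] in fastforce)

text \<open>A price vector refuting \<open>t\<close> is positive and increasing in the capacity.
  Abel summation shows that under such prices a supply with larger suffix sums has at least the same
  value, so the same prices would refute \<open>s\<close>.\<close>

lemma fractional_cover_upward:
  assumes perm: "\<pi> permutes {..<n}" and mono: "\<And>k l. k \<le> l \<Longrightarrow> l < n \<Longrightarrow> c (\<pi> k) \<le> c (\<pi> l)"
    and s: "fractional_cover s" and t: "\<And>j. j < n \<Longrightarrow> 0 \<le> t j"
    and dom: "\<And>i. i < n \<Longrightarrow> (\<Sum>k\<in>{i..<n}. s (\<pi> k)) \<le> (\<Sum>k\<in>{i..<n}. t (\<pi> k))"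
  shows "fractional_cover t"
proof (rule ccontr)
  assume "\<not> fractional_cover t"
  from strong_duality[OF t this]
  obtain w y where wy: "dual_feasible w y" "(\<Sum>j<n. y j * t j) < (\<Sum>i<m. w i * D i)"
    by (auto simp: prices_def)
  define Y where "Y k = y (\<pi> k)" for k
  define g where "g k = t (\<pi> k) - s (\<pi> k)" for k
  have \<pi>: "\<pi> k < n" if "k < n" for k using permutes_in_image[OF perm, of k] that by simp
  have Y0: "0 < Y k" if "k < n" for k
    using wy(1) \<pi>[OF that] by (auto simp: Y_def dual_feasible_def)
  have Y: "Y k \<le> Y l" if "k \<le> l" "l < n" for k l
    using wy(1) \<pi>[of k] \<pi>[of l] mono[OF that] that by (auto simp: Y_def dual_feasible_def)
  \<comment> \<open>Summation by parts from the top: raising the factor from \<open>Y i\<close> to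
    \<open>Y (Suc i)\<close> is allowed since the suffix sum behind it is non-negative.\<close>
  have "Y i * (\<Sum>k\<in>{i..<n}. g k) \<le> (\<Sum>k\<in>{i..<n}. Y k * g k)" if "i \<le> n" for i
    using that
  proof (induction rule: inc_induct)
    case (step i)
    show ?case
    proof (cases "Suc i < n")
      case True
      have "0 \<le> (\<Sum>k\<in>{Suc i..<n}. g k)"
        using dom[OF True] by (simp add: g_def sum_subtractf)
      then have "Y i * (\<Sum>k\<in>{Suc i..<n}. g k) \<le> Y (Suc i) * (\<Sum>k\<in>{Suc i..<n}. g k)"
        using Y[of i "Suc i"] True by (intro mult_right_mono) auto
      with step show ?thesis by (simp add: sum.atLeast_Suc_lessThan algebra_simps)
    next
      case False
      then have "{i..<n} = {i}" using step.hyps by auto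
      then show ?thesis by simp
    qed
  qed simp
  then have 0: "Y 0 * (\<Sum>k\<in>{0..<n}. g k) \<le> (\<Sum>k\<in>{0..<n}. Y k * g k)" by simp
  have "0 \<le> (\<Sum>k<n. Y k * g k)"
  proof (cases "n = 0")
    case False
    then have "0 \<le> (\<Sum>k\<in>{0..<n}. g k)" using dom[of 0] by (simp add: g_def sum_subtractf)
    then have "0 \<le> Y 0 * (\<Sum>k\<in>{0..<n}. g k)" using Y0[of 0] False by simp
    then show ?thesis using 0 by (simp add: atLeast0LessThan)
  qed simp
  also have "(\<Sum>k<n. Y k * g k) = (\<Sum>j<n. y j * (t j - s j))"
    using sum.permute[OF perm, of "\<lambda>j. y j * (t j - s j)"] by (simp add: Y_def g_def o_def)
  finally have "(\<Sum>j<n. y j * s j) \<le> (\<Sum>j<n. y j * t j)"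
    by (simp add: algebra_simps sum_subtractf)
  with wy weak_duality[OF s wy(1)] show False by simp
qed

end

section \<open>Rounding\<close>

context covering
begin

definition load :: "(nat \<Rightarrow> nat option) \<Rightarrow> nat \<Rightarrow> real" where
  "load f i = (\<Sum>k | k < n \<and> f k = Some i. gain i k)"

text \<open>
  Rounding for unit supplies: a job goes to the machine that finishes it. As jobs come in
  decreasing order, the piece of a later job that a machine loses is worth at most as much as any
  job that it finishes. A machine that finishes no job before its last piece must have consumed one
  entire job, which it then keeps. In the invariant, \<open>x\<close> is the amount of job \<open>j\<close> that machine
  \<open>i\<close> has consumed.
\<close>

definition rounding ::
    "nat set \<Rightarrow> nat \<Rightarrow> nat set \<Rightarrow> nat \<Rightarrow> real \<Rightarrow> real \<Rightarrow> (nat \<Rightarrow> nat option) \<Rightarrow> real \<Rightarrow> bool" where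
  "rounding U i V j r d f x \<longleftrightarrow>
     (\<forall>k\<in>U. D k \<le> 2 * load f k) \<and> (\<forall>k. f k \<noteq> None \<longrightarrow> k \<in> insert j V) \<and>
     (\<forall>k q. f k = Some q \<longrightarrow> q \<in> insert i U) \<and>
     D i - d \<le> load f i + x * gain i j \<and> 0 \<le> x \<and> x \<le> 1 - r \<and>
     (f j \<noteq> None \<longrightarrow> x = 0 \<and> r = 0 \<and> f j \<noteq> Some i)"

lemma load_update:
  assumes "f j = None" "j < n"
  shows "load (f(j := Some i)) k = load f k + (if k = i then gain i j else 0)"
proof (cases "k = i")
  case True
  have "{l. l < n \<and> (f(j := Some i)) l = Some i} = insert j {l. l < n \<and> f l = Some i}"
    using assms by auto
  with True assms show ?thesis by (simp add: load_def)
next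
  case False
  then have "{l. l < n \<and> (f(j := Some i)) l = Some k} = {l. l < n \<and> f l = Some k}"
    using assms by auto
  with False show ?thesis by (simp add: load_def)
qed

text \<open>Only the last piece, a fraction \<open>x' \<le> 1\<close> of \<open>j\<close>, can be
  missing from the load. If the machine holds some job \<open>k\<close>, then \<open>k\<close> came
  earlier, so \<open>gain i j \<le> gain i k\<close> and the loss is at most the load itself. If it
  holds none, then \<open>D i \<le> x' * gain i j\<close> and \<open>gain i j \<le> D i\<close>
  force \<open>x' = 1\<close>: the machine has eaten all of \<open>j\<close>, no remainder is left
  for others, and it may keep the job.\<close>

lemma rounding_satisfied:
  assumes g: "greedy (\<lambda>_. 1) U i V j w y r d" and inv: "rounding U i V j r d f x"
    and sat: "d \<le> r * gain i j"
  shows "\<exists>f'. (\<forall>k\<in>insert i U. D k \<le> 2 * load f' k) \<and> (\<forall>k. f' k \<noteq> None \<longrightarrow> k \<in> insert j V) \<and>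
    (\<forall>k q. f' k = Some q \<longrightarrow> q \<in> insert i U) \<and> (f' j \<noteq> None \<longrightarrow> r - d / gain i j = 0)"
proof -
  note sorted = greedy_sorted[OF g]
  have rd: "0 \<le> r" "0 < d" using greedy_pos[OF g] by auto
  have gpos: "0 < gain i j" using sorted gain_pos by auto
  \<comment> \<open>A positive demand is met only from a positive remainder, whereas a job already
    given away has \<open>r = 0\<close>.\<close>
  have fj: "f j = None" using inv sat rd by (auto simp: rounding_def)
  define x' where "x' = x + d / gain i j"
  have "d / gain i j \<le> r" using sat gpos by (simp add: divide_le_eq)
  then have x': "x' \<le> 1" using inv by (auto simp: rounding_def x'_def)
  have Di: "D i \<le> load f i + x' * gain i j"
    using inv gpos by (auto simp: rounding_def x'_def algebra_simps)
  have xg: "x' * gain i j \<le> gain i j" using x' gpos by simp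
  show ?thesis
  proof (cases "{k. k < n \<and> f k = Some i} = {}")
    case False
    then obtain k where k: "k < n" "f k = Some i" by auto
    then have "k \<noteq> j" using fj by auto
    then have "k \<in> V" using inv k by (auto simp: rounding_def)
    then have "gain i j \<le> gain i k" using sorted by (intro gain_mono) auto
    also have "gain i k \<le> load f i" unfolding load_def
      using k sorted gain_pos[of i] by (intro member_le_sum) (auto intro: less_imp_le)
    finally have "D i \<le> 2 * load f i" using Di xg by simp
    then show ?thesis using inv fj by (intro exI[of _ f]) (auto simp: rounding_def)
  next
    case True
    have 0: "load f i = 0" unfolding load_def True by simp
    have eq: "gain i j = D i" using 0 Di xg gain_le(1)[of i j] by simp
    then have "1 \<le> x'" using Di 0 gpos by simp
    then have "r - d / gain i j = 0"
      using inv \<open>d / gain i j \<le> r\<close> by (auto simp: rounding_def x'_def)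
    moreover have "D k \<le> 2 * load (f(j := Some i)) k" if "k \<in> insert i U" for k
      using that inv load_update[of f j i k] fj sorted eq 0 gpos
      by (auto simp: rounding_def split: if_splits)
    ultimately show ?thesis
      using inv by (intro exI[of _ "f(j := Some i)"]) (auto simp: rounding_def split: if_splits)
  qed
qed

lemma greedy_rounding:
  assumes "greedy (\<lambda>_. 1) U i V j w y r d"
  shows "\<exists>f x. rounding U i V j r d f x"
  using assms
proof (induction rule: greedy.induct)
  case (start i j)
  then show ?case by (intro exI[of _ "\<lambda>_. None"] exI[of _ 0]) (auto simp: rounding_def load_def)
next
  case (next_job U i V j w y r d l)
  note sorted = greedy_sorted[OF next_job.hyps(1)]
  have r: "0 \<le> r" using greedy_pos[OF next_job.hyps(1)] by simp
  have l: "l < n" "l \<notin> insert j V" using next_job.hyps(3) by (auto simp: greatest_on_def)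
  obtain f x where inv: "rounding U i V j r d f x" using next_job.IH by blast
  have fl: "f l = None" using inv l unfolding rounding_def by blast
  show ?case
  proof (cases "f j = None")
    case True
    \<comment> \<open>The machine finishing \<open>j\<close> receives the whole job, which is worth
      at least the part \<open>x + r \<le> 1\<close> that it consumed.\<close>
    have "(x + r) * gain i j \<le> 1 * gain i j"
      using inv gain_pos[of i j] sorted by (intro mult_right_mono) (auto simp: rounding_def)
    then have "D i - (d - r * gain i j) \<le> load (f(j := Some i)) i"
      using inv sorted load_update[of f j i i] True by (auto simp: rounding_def algebra_simps)
    moreover have "D k \<le> 2 * load (f(j := Some i)) k" if "k \<in> U" for k
      using that inv load_update[of f j i k] True sorted by (auto simp: rounding_def)
    ultimately have "rounding U i (insert j V) l 1 (d - r * gain i j) (f(j := Some i)) 0"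
      using inv fl l by (auto simp: rounding_def)
    then show ?thesis by blast
  next
    case False
    \<comment> \<open>Here \<open>j\<close> was kept by an earlier machine and arrived with
      \<open>r = 0\<close>, so nothing is consumed and the assignment stays unchanged.\<close>
    then have "rounding U i (insert j V) l 1 (d - r * gain i j) f 0"
      using inv fl by (auto simp: rounding_def)
    then show ?thesis by blast
  qed
next
  case (next_machine U i V j w y r d h)
  note sorted = greedy_sorted[OF next_machine.hyps(1)]
  have h: "h < m" "h \<notin> insert i U" using next_machine.hyps(3) by (auto simp: greatest_on_def)
  have "d / gain i j \<le> r" using next_machine.hyps(2) gain_pos[of i j] sorted
    by (simp add: divide_le_eq)
  obtain f x where inv: "rounding U i V j r d f x" using next_machine.IH by blast
  obtain f' where f': "\<forall>k\<in>insert i U. D k \<le> 2 * load f' k" "\<forall>k. f' k \<noteq> None \<longrightarrow> k \<in> insert j V"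
    "\<forall>k q. f' k = Some q \<longrightarrow> q \<in> insert i U" "f' j \<noteq> None \<longrightarrow> r - d / gain i j = 0"
    using rounding_satisfied[OF next_machine.hyps(1) inv next_machine.hyps(2)] by blast
  have none: "f' k \<noteq> Some h" for k using f'(3) h by blast
  have "load f' h = 0" using none by (simp add: load_def)
  moreover have "0 \<le> 1 - (r - d / gain i j)"
  proof -
    have "0 \<le> d / gain i j" "r \<le> 1"
      using inv greedy_pos[OF next_machine.hyps(1)] gain_pos[of i j] sorted
      unfolding rounding_def by auto
    then show ?thesis by linarith
  qed
  ultimately have "rounding (insert i U) h V j (r - d / gain i j) (D h) f' 0"
    using f' none by (auto simp: rounding_def)
  then show ?case by blast
qed

text \<open>Weak duality excludes a failing run, so the last machine is satisfied too. Loads count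
  truncated capacities and hence only underestimate the true ones.\<close>

lemma fractional_cover_rounding:
  assumes "fractional_cover (\<lambda>_. 1)"
  shows "\<exists>f. \<forall>i<m. D i \<le> 2 * (\<Sum>k | k < n \<and> f k = Some i. c k)"
proof (cases "m = 0 \<or> n = 0")
  case True
  have "m = 0"
  proof (rule ccontr)
    assume "m \<noteq> 0"
    then have "D 0 \<le> 0" using True assms unfolding fractional_cover_def by auto
    then show False using D_pos[of 0] \<open>m \<noteq> 0\<close> by simp
  qed
  then show ?thesis by simp
next
  case False
  then obtain U i V j w y r d where g: "greedy (\<lambda>_. 1) U i V j w y r d"
    "d \<le> r * gain i j \<and> {..<m} \<subseteq> insert i U \<or> r * gain i j < d \<and> {..<n} \<subseteq> insert j V"
    using greedy_initial[of "\<lambda>_. 1"] greedy_terminates[of "\<lambda>_. 1"] by (metis neq0_conv)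
  have suc: "d \<le> r * gain i j" "{..<m} \<subseteq> insert i U"
    using g(2) greedy_failure[OF g(1)] weak_duality[OF assms, of w y] by auto
  obtain f x where "rounding U i V j r d f x" using greedy_rounding[OF g(1)] by blast
  from rounding_satisfied[OF g(1) this suc(1)]
  obtain f' where f': "\<And>k. k < m \<Longrightarrow> D k \<le> 2 * load f' k" using suc(2) by blast
  have "load f' i \<le> (\<Sum>k | k < n \<and> f' k = Some i. c k)" for i
    unfolding load_def by (intro sum_mono gain_le)
  then have "D i \<le> 2 * (\<Sum>k | k < n \<and> f' k = Some i. c k)" if "i < m" for i
    by (rule order_trans[OF f'[OF that] mult_left_mono]) simp
  then show ?thesis by blast
qed

end

section \<open>The assignment polyhedron\<close>

lemma Qcmin_covering:
  assumes "Qcmin_instance D c"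
  shows "covering (dim_vec D) (dim_vec c) (($) D) (($) c)"
  using assms by unfold_locales (auto simp: Qcmin_instance_def)

abbreviation vec_cover :: "real vec \<Rightarrow> real vec \<Rightarrow> (nat \<Rightarrow> real) \<Rightarrow> bool" where
  "vec_cover D c \<equiv> covering.fractional_cover (dim_vec D) (dim_vec c) (($) D) (($) c)"

lemma mem_P_ass_iff:
  assumes "Qcmin_instance D c"
  shows "s \<in> P_ass D c \<longleftrightarrow> s \<in> carrier_vec (dim_vec c) \<and> vec_cover D c (($) s)"
proof -
  interpret covering "dim_vec D" "dim_vec c" "($) D" "($) c" using Qcmin_covering[OF assms] .
  show ?thesis unfolding P_ass_def fractional_cover_def gain_def by simp
qed

lemma is_polyhedron_halfspaces:
  assumes "finite C"
  shows "is_polyhedron n {x \<in> carrier_vec n. \<forall>(a, b)\<in>C. (\<Sum>j<n. a j * x $ j) \<le> b}"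
proof -
  obtain xs where xs: "set xs = C" using finite_list[OF assms] by blast
  define A where "A = mat (length xs) n (\<lambda>(i, j). fst (xs ! i) j)"
  define b where "b = vec (length xs) (\<lambda>i. snd (xs ! i))"
  have "A *\<^sub>v x \<le> b \<longleftrightarrow> (\<forall>(a, b)\<in>C. (\<Sum>j<n. a j * x $ j) \<le> b)" if "x \<in> carrier_vec n" for x
  proof -
    have "(A *\<^sub>v x) $ i = (\<Sum>j<n. fst (xs ! i) j * x $ j)" if i: "i < length xs" for i
      using i \<open>x \<in> carrier_vec n\<close>
      by (auto simp: A_def scalar_prod_def atLeast0LessThan intro!: sum.cong)
    then have "A *\<^sub>v x \<le> b \<longleftrightarrow>
        (\<forall>i<length xs. (\<Sum>j<n. fst (xs ! i) j * x $ j) \<le> snd (xs ! i))"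
      by (auto simp: less_eq_vec_def A_def b_def)
    also have "\<dots> \<longleftrightarrow> (\<forall>p\<in>C. (\<Sum>j<n. fst p j * x $ j) \<le> snd p)"
      unfolding xs[symmetric] by (simp add: all_set_conv_all_nth)
    finally show ?thesis by (simp add: case_prod_unfold)
  qed
  then have "{x \<in> carrier_vec n. \<forall>(a, b)\<in>C. (\<Sum>j<n. a j * x $ j) \<le> b} =
      {x \<in> carrier_vec n. A *\<^sub>v x \<le> b}" by blast
  moreover have "A \<in> carrier_mat (length xs) n" "b \<in> carrier_vec (length xs)"
    by (auto simp: A_def b_def)
  ultimately show ?thesis unfolding is_polyhedron_def by blast
qed

lemma is_polyhedron_P_ass:
  assumes "Qcmin_instance D c"
  shows "is_polyhedron (dim_vec c) (P_ass D c)"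
proof -
  interpret covering "dim_vec D" "dim_vec c" "($) D" "($) c" using Qcmin_covering[OF assms] .
  let ?m = "dim_vec D" and ?n = "dim_vec c"
  define C where "C = (\<lambda>j. (\<lambda>k. if k = j then -1 else 0, 0 :: real)) ` {..<?n} \<union>
    (\<lambda>(w, y). (\<lambda>j. - y j, - (\<Sum>i<?m. w i * D $ i))) ` prices"
  have "(\<Sum>k<?n. (if k = j then -1 else 0) * x $ k) = - x $ j" if "j < ?n" for j and x :: "real vec"
  proof -
    have "(\<Sum>k<?n. (if k = j then -1 else 0) * x $ k) = (\<Sum>k<?n. if k = j then - x $ k else 0)"
      by (intro sum.cong) auto
    then show ?thesis using that by simp
  qed
  then have "vec_cover D c (($) x) \<longleftrightarrow> (\<forall>(a, b)\<in>C. (\<Sum>j<?n. a j * x $ j) \<le> b)" for x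
    unfolding fractional_cover_iff C_def by (auto simp: ball_Un sum_negf)
  then have "P_ass D c = {x \<in> carrier_vec ?n. \<forall>(a, b)\<in>C. (\<Sum>j<?n. a j * x $ j) \<le> b}"
    using mem_P_ass_iff[OF assms] by auto
  moreover have "finite C" unfolding C_def using finite_prices by simp
  ultimately show ?thesis by (simp add: is_polyhedron_halfspaces)
qed

section \<open>Integral supplies and assignments of single jobs\<close>

lemma finite_jobs: "finite (jobs s)"
proof -
  have "jobs s = Sigma {..<dim_vec s} (\<lambda>j. {..<s $ j})" by (auto simp: jobs_def)
  then show ?thesis by simp
qed

lemma sum_jobs: "(\<Sum>p\<in>jobs s. g p) = (\<Sum>j<dim_vec s. \<Sum>k<s $ j. g (j, k))"
proof -
  have "jobs s = Sigma {..<dim_vec s} (\<lambda>j. {..<s $ j})" by (auto simp: jobs_def)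
  then show ?thesis by (simp add: sum.Sigma)
qed

text \<open>Truncation at \<open>D i\<close> costs nothing: either some assigned job alone reaches
  the demand, and its truncated size is exactly \<open>D i\<close>, or no assigned job is truncated
  at all.\<close>

lemma can_cover_imp_P_ass:
  assumes inst: "Qcmin_instance D c" and s: "s \<in> carrier_vec (dim_vec c)" and cov: "can_cover D c s"
  shows "map_vec real s \<in> P_ass D c"
proof -
  let ?m = "dim_vec D" and ?n = "dim_vec c"
  obtain f :: "nat \<times> nat \<Rightarrow> nat option" where
    f: "\<And>i. i < ?m \<Longrightarrow> D $ i \<le> (\<Sum>(j, k)\<in>{p \<in> jobs s. f p = Some i}. c $ j)"
    using cov unfolding can_cover_def by blast
  define z where "z i j = (\<Sum>k<s $ j. if f (j, k) = Some i then 1 else 0 :: real)" for i j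
  have dim: "dim_vec s = ?n" using s by auto
  have pos: "0 < D $ i" if "i < ?m" for i using inst that by (simp add: Qcmin_instance_def)
  have cpos: "0 < c $ j" if "j < ?n" for j using inst that by (simp add: Qcmin_instance_def)
  show ?thesis unfolding P_ass_def
  proof (intro CollectI conjI exI[of _ z] allI impI)
    show "map_vec real s \<in> carrier_vec ?n" using s by simp
    show "0 \<le> z i j" for i j by (simp add: z_def sum_nonneg)
    show "(\<Sum>i<?m. z i j) \<le> map_vec real s $ j" if "j < ?n" for j
    proof -
      have "(\<Sum>i<?m. z i j) = (\<Sum>k<s $ j. \<Sum>i<?m. if f (j, k) = Some i then 1 else 0)"
        unfolding z_def by (rule sum.swap)
      also have "\<dots> \<le> (\<Sum>k<s $ j. 1)"
      proof (rule sum_mono)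
        fix k
        show "(\<Sum>i<?m. if f (j, k) = Some i then 1 else 0 :: real) \<le> 1"
          by (cases "f (j, k)") auto
      qed
      finally show ?thesis using that dim by simp
    qed
    show "D $ i \<le> (\<Sum>j<?n. z i j * min (c $ j) (D $ i))" if i: "i < ?m" for i
    proof -
      let ?F = "{p \<in> jobs s. f p = Some i}"
      have fin: "finite ?F" using finite_jobs by simp
      have "(\<Sum>j<?n. z i j * min (c $ j) (D $ i)) =
          (\<Sum>p\<in>jobs s. (if f p = Some i then min (c $ fst p) (D $ i) else 0))"
        unfolding sum_jobs dim z_def by (auto simp: sum_distrib_right intro!: sum.cong)
      also have "\<dots> = (\<Sum>p\<in>?F. min (c $ fst p) (D $ i))"
        by (simp add: sum.inter_filter finite_jobs)
      finally have eq: "(\<Sum>j<?n. z i j * min (c $ j) (D $ i)) = (\<Sum>p\<in>?F. min (c $ fst p) (D $ i))" .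
      have nonneg: "0 \<le> min (c $ fst p) (D $ i)" if "p \<in> ?F" for p
        using that cpos[of "fst p"] pos[OF i] dim by (auto simp: jobs_def)
      show ?thesis
      proof (cases "\<exists>p\<in>?F. D $ i \<le> c $ fst p")
        case True
        then obtain p where p: "p \<in> ?F" "D $ i \<le> c $ fst p" by blast
        then have "D $ i = min (c $ fst p) (D $ i)" by simp
        also have "\<dots> \<le> (\<Sum>p\<in>?F. min (c $ fst p) (D $ i))"
          using p(1) nonneg fin by (intro member_le_sum) auto
        finally show ?thesis using eq by simp
      next
        case False
        then have "(\<Sum>p\<in>?F. min (c $ fst p) (D $ i)) = (\<Sum>(j, k)\<in>?F. c $ j)"
          by (intro sum.cong refl) (force simp: min_def not_le intro: less_imp_le)
        then show ?thesis using f[OF i] eq by simp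
      qed
    qed
  qed
qed

text \<open>Every job becomes a type of its own with supply 1, and the fractional amount of a type
  is shared equally among its copies. Thus rounding is needed only for unit supplies.\<close>

lemma P_ass_imp_can_cover:
  assumes inst: "Qcmin_instance D c" and s: "s \<in> carrier_vec (dim_vec c)"
    and mem: "map_vec real s \<in> P_ass D c"
  shows "can_cover ((1 / 2) \<cdot>\<^sub>v D) c s"
proof -
  let ?m = "dim_vec D" and ?n = "dim_vec c"
  have dim: "dim_vec s = ?n" using s by auto
  obtain z :: "nat \<Rightarrow> nat \<Rightarrow> real" where z: "\<And>i j. i < ?m \<Longrightarrow> j < ?n \<Longrightarrow> 0 \<le> z i j"
    "\<And>j. j < ?n \<Longrightarrow> (\<Sum>i<?m. z i j) \<le> real (s $ j)"
    "\<And>i. i < ?m \<Longrightarrow> D $ i \<le> (\<Sum>j<?n. z i j * min (c $ j) (D $ i))"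
    using mem dim unfolding P_ass_def by auto
  define N where "N = card (jobs s)"
  obtain h where h: "bij_betw h {..<N} (jobs s)"
    using ex_bij_betw_nat_finite[OF finite_jobs] unfolding N_def atLeast0LessThan by blast
  have hj: "fst (h k) < ?n" "0 < s $ fst (h k)" if "k < N" for k
  proof -
    have "h k \<in> jobs s" using bij_betwE[OF h] that by blast
    then show "fst (h k) < ?n" "0 < s $ fst (h k)" using dim by (auto simp: jobs_def)
  qed
  define c' where "c' k = c $ fst (h k)" for k
  interpret covering ?m N "($) D" c'
    using inst hj by unfold_locales (auto simp: Qcmin_instance_def c'_def)
  \<comment> \<open>A type without copies has no single jobs to carry its amounts, so these must
    vanish for the row sums to be preserved.\<close>
  have z0: "z i j = 0" if "i < ?m" "j < ?n" "s $ j = 0" for i j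
  proof -
    have "z i j \<le> (\<Sum>i<?m. z i j)" using z(1) that by (intro member_le_sum) auto
    then show ?thesis using z(1)[OF that(1,2)] z(2)[OF that(2)] that(3) by simp
  qed
  have "fractional_cover (\<lambda>_. 1)" unfolding fractional_cover_def
  proof (intro exI[of _ "\<lambda>i k. z i (fst (h k)) / s $ fst (h k)"] conjI allI impI)
    show "0 \<le> z i (fst (h k)) / s $ fst (h k)" if "i < ?m" "k < N" for i k
      using z(1) that hj by simp
    show "(\<Sum>i<?m. z i (fst (h k)) / s $ fst (h k)) \<le> 1" if "k < N" for k
      using z(2)[OF hj(1)[OF that]] hj(2)[OF that]
      by (simp add: sum_divide_distrib[symmetric] divide_le_eq)
    show "D $ i \<le> (\<Sum>k<N. z i (fst (h k)) / s $ fst (h k) * gain i k)" if i: "i < ?m" for i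
    proof -
      have "(\<Sum>k<N. z i (fst (h k)) / s $ fst (h k) * gain i k) =
          (\<Sum>p\<in>jobs s. z i (fst p) / s $ fst p * min (c $ fst p) (D $ i))"
        unfolding gain_def c'_def using sum.reindex_bij_betw[OF h] by simp
      also have "\<dots> = (\<Sum>j<?n. z i j * min (c $ j) (D $ i))"
        unfolding sum_jobs dim using z0[OF i] by (auto intro!: sum.cong)
      finally show ?thesis using z(3)[OF i] by simp
    qed
  qed
  then obtain f where f: "\<And>i. i < ?m \<Longrightarrow> D $ i \<le> 2 * (\<Sum>k | k < N \<and> f k = Some i. c' k)"
    using fractional_cover_rounding by blast
  define f' where "f' p = f (the_inv_into {..<N} h p)" for p
  have f'h: "f' (h k) = f k" if "k < N" for k
    using that h by (simp add: f'_def bij_betw_def the_inv_into_f_f)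
  have "(\<Sum>(j, k)\<in>{p \<in> jobs s. f' p = Some i}. c $ j) = (\<Sum>k | k < N \<and> f k = Some i. c' k)" for i
  proof -
    have "bij_betw h {k. k < N \<and> f k = Some i} {p \<in> jobs s. f' p = Some i}"
    proof (rule bij_betw_subset[OF h])
      have "jobs s = h ` {..<N}" using h by (simp add: bij_betw_def)
      then show "h ` {k. k < N \<and> f k = Some i} = {p \<in> jobs s. f' p = Some i}"
        using f'h by auto
    qed auto
    then show ?thesis
      by (subst sum.reindex_bij_betw[symmetric]) (auto simp: c'_def case_prod_unfold)
  qed
  moreover have "D $ i / 2 \<le> (\<Sum>k | k < N \<and> f k = Some i. c' k)" if "i < ?m" for i
    using f[OF that] by simp
  ultimately show ?thesis unfolding can_cover_def by (intro exI[of _ f']) simp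
qed

lemma approx_supply_polyhedron_P_ass:
  assumes "Qcmin_instance D c"
  shows "approx_supply_polyhedron 2 D c (P_ass D c)"
  unfolding approx_supply_polyhedron_def
  using is_polyhedron_P_ass can_cover_imp_P_ass P_ass_imp_can_cover assms by blast

lemma upward_feasible_P_ass:
  assumes "Qcmin_instance D c"
  shows "upward_feasible c (P_ass D c)"
proof -
  interpret covering "dim_vec D" "dim_vec c" "($) D" "($) c" using Qcmin_covering[OF assms] .
  show ?thesis unfolding upward_feasible_def mem_P_ass_iff[OF assms]
  proof (intro allI ballI impI, elim conjE, intro conjI)
    fix \<pi> s t
    assume \<pi>: "\<pi> permutes {..<dim_vec c}" "\<forall>k l. k \<le> l \<and> l < dim_vec c \<longrightarrow> c $ \<pi> k \<le> c $ \<pi> l"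
      and s: "s \<in> P_ass D c" and t: "t \<in> carrier_vec (dim_vec c)" "0\<^sub>v (dim_vec c) \<le> t"
      "\<forall>i<dim_vec c. (\<Sum>k\<in>{i..<dim_vec c}. s $ \<pi> k) \<le> (\<Sum>k\<in>{i..<dim_vec c}. t $ \<pi> k)"
    show "fractional_cover (($) t)"
      by (rule fractional_cover_upward[OF \<pi>(1), where s = "($) s"])
        (use \<pi> t s mem_P_ass_iff[OF assms] in \<open>auto simp: less_eq_vec_def\<close>)
  qed
qed

section \<open>Total correctness with cost bounds\<close>

definition terminates :: "(real \<Rightarrow> nat) \<Rightarrow> com \<Rightarrow> store \<Rightarrow> nat \<Rightarrow> (store \<Rightarrow> bool) \<Rightarrow> bool" where
  "terminates wt p s K Q \<longleftrightarrow> (\<exists>k s'. run wt p s k s' \<and> k \<le> K \<and> Q s')"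

lemma terminates_mono:
  "terminates wt p s K Q \<Longrightarrow> K \<le> K' \<Longrightarrow> (\<And>s'. Q s' \<Longrightarrow> Q' s') \<Longrightarrow> terminates wt p s K' Q'"
  unfolding terminates_def by (meson order_trans)

lemma terminates_Skip: "1 \<le> K \<Longrightarrow> Q s \<Longrightarrow> terminates wt Skip s K Q"
  unfolding terminates_def by (meson run.Skip)

lemma terminates_IdxClear: "1 \<le> K \<Longrightarrow> Q (set_idx r 0 s) \<Longrightarrow> terminates wt (IdxClear r) s K Q"
  unfolding terminates_def by (meson run.IdxClear)

lemma terminates_IdxCopy:
  "1 \<le> K \<Longrightarrow> Q (set_idx r (idx s q) s) \<Longrightarrow> terminates wt (IdxCopy r q) s K Q"
  unfolding terminates_def by (meson run.IdxCopy)

lemma terminates_IdxIncr: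
  "1 \<le> K \<Longrightarrow> Q (set_idx r (Suc (idx s r)) s) \<Longrightarrow> terminates wt (IdxIncr r) s K Q"
  unfolding terminates_def by (meson run.IdxIncr)

lemma terminates_Assign:
  "rexp_cost wt e s \<le> K \<Longrightarrow> Q (put u (rval e s) s) \<Longrightarrow> terminates wt (Assign u e) s K Q"
  unfolding terminates_def by (meson run.Assign)

lemma terminates_Seq:
  assumes "terminates wt p s K (\<lambda>s'. terminates wt q s' K' Q)"
  shows "terminates wt (Seq p q) s (K + K') Q"
  using assms unfolding terminates_def by (meson run.Seq add_mono)

lemma terminates_Cond:
  assumes "test_cost wt t s \<le> K" "holds t s \<Longrightarrow> terminates wt p s K' Q"
    "\<not> holds t s \<Longrightarrow> terminates wt q s K' Q"
  shows "terminates wt (Cond t p q) s (K + K') Q"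
proof (cases "holds t s")
  case True
  then show ?thesis using assms unfolding terminates_def by (meson run.CondTrue add_mono)
next
  case False
  then show ?thesis using assms unfolding terminates_def by (meson run.CondFalse add_mono)
qed

text \<open>The variant \<open>v\<close> is an index of the invariant and bounds the number of
  rounds: each unit of it pays for one test and one body, and the final \<open>K\<close> pays for
  the test that fails.\<close>

lemma terminates_While:
  assumes "I v s" and test: "\<And>v s. I v s \<Longrightarrow> test_cost wt t s \<le> K"
    and body: "\<And>v s. I v s \<Longrightarrow> holds t s \<Longrightarrow> \<exists>v'<v. terminates wt p s K' (I v')"
  shows "terminates wt (While t p) s (v * (K + K') + K) (\<lambda>s'. (\<exists>v'. I v' s') \<and> \<not> holds t s')"
  using assms(1)
proof (induction v arbitrary: s rule: less_induct)
  case (less v s)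
  note cost = test[OF less.prems]
  show ?case
  proof (cases "holds t s")
    case False
    then have "run wt (While t p) s (test_cost wt t s) s" by (rule run.WhileFalse)
    then show ?thesis unfolding terminates_def using cost less.prems False
      by (meson trans_le_add2)
  next
    case True
    obtain v' k s1 where v': "v' < v" "run wt p s k s1" "k \<le> K'" "I v' s1"
      using body[OF less.prems True] unfolding terminates_def by blast
    obtain k' s2 where s2: "run wt (While t p) s1 k' s2" "k' \<le> v' * (K + K') + K"
      "(\<exists>v'. I v' s2) \<and> \<not> holds t s2"
      using less.IH[OF v'(1,4)] unfolding terminates_def by blast
    have "Suc v' * (K + K') \<le> v * (K + K')" using v'(1) by (intro mult_right_mono) auto
    then have "test_cost wt t s + k + k' \<le> v * (K + K') + K"
      using cost v'(3) s2(2) by simp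
    then show ?thesis unfolding terminates_def
      using run.WhileTrue[OF True v'(2) s2(1)] s2(3) by blast
  qed
qed

section \<open>The separation program\<close>

text \<open>
  Registers: 0 and 1 hold \<open>m\<close> and \<open>n\<close>, 2 and 3 the current machine and job type, 4 is a counter,
  and 5 holds 0. Array 3 stores the prices of the job types. Position 0 of the arrays 4 to 11 holds:
  demand of the current machine, capacity of the current job type, gain, remaining jobs, remaining
  demand, price of the current machine, right-hand side, temporary value. Used entries of the arrays
  0 and 1 are overwritten by 0, so that a search for the maximum skips them.
\<close>

definition search :: "nat \<Rightarrow> nat \<Rightarrow> nat \<Rightarrow> com" where
  "search a len dest = Seq (IdxCopy dest len) (Seq (IdxClear 4)
     (While (IdxLess 4 len)
       (Seq (Cond (RealLess (a, dest) (a, 4)) (IdxCopy dest 4) Skip) (IdxIncr 4))))"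

definition update_gain :: com where
  "update_gain = Cond (RealLess (4, 5) (5, 5)) (Assign (6, 5) (Get (4, 5))) (Assign (6, 5) (Get (5, 5)))"

definition load_machine :: com where
  "load_machine = Seq (search 0 0 2) (Seq (Assign (4, 5) (Get (0, 2))) (Seq (Assign (0, 2) Zero)
     (Seq (Assign (8, 5) (Get (4, 5))) update_gain)))"

definition load_job :: com where
  "load_job = Seq (search 1 1 3) (Seq (Assign (5, 5) (Get (1, 3))) (Seq (Assign (1, 3) Zero)
     (Seq (Assign (7, 5) (Get (2, 3))) (Seq update_gain
     (Assign (3, 3) (Arith Mul (9, 5) (6, 5)))))))"

text \<open>The job price \<open>w i * gain i j\<close> has to be saved in array 11 before
  \<open>load_machine\<close> overwrites the gain; divided by the new gain, it is the price of the
  new machine.\<close>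

definition change_machine :: com where
  "change_machine = Seq (Assign (11, 5) (Arith Div (8, 5) (6, 5)))
     (Seq (Assign (7, 5) (Arith Sub (7, 5) (11, 5)))
     (Seq (Assign (11, 5) (Arith Mul (9, 5) (6, 5)))
     (Seq load_machine
     (Seq (Assign (9, 5) (Arith Div (11, 5) (6, 5)))
     (Seq (Assign (11, 5) (Arith Mul (9, 5) (4, 5)))
     (Assign (10, 5) (Arith Add (10, 5) (11, 5))))))))"

text \<open>Array 11 still holds \<open>r * gain i j\<close>, computed for the test in
  \<open>main_loop\<close>.\<close>

definition change_job :: com where
  "change_job = Seq (Assign (8, 5) (Arith Sub (8, 5) (11, 5))) load_job"

definition initialize :: com where
  "initialize = Seq load_machine (Seq (Assign (9, 5) One) (Seq (Assign (10, 5) (Get (4, 5))) load_job))"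

definition main_loop :: com where
  "main_loop = While (Conj (IdxLess 2 0) (IdxLess 3 1))
     (Seq (Assign (11, 5) (Arith Mul (7, 5) (6, 5)))
       (Cond (RealLess (11, 5) (8, 5)) change_job change_machine))"

text \<open>Register 0 doubles as the flag read by \<open>oracle_answer\<close>. If a machine is
  left over, it still holds \<open>m > 0\<close>, so it is cleared only for a positive
  answer.\<close>

definition output_answer :: com where
  "output_answer = Cond (IdxLess 2 0)
     (Seq (IdxClear 4) (Seq (While (IdxLess 4 1) (Seq (Assign (0, 4) (Get (3, 4))) (IdxIncr 4)))
       (Assign (1, 5) (Get (10, 5)))))
     (IdxClear 0)"

definition separation_program :: com where
  "separation_program = Seq initialize (Seq main_loop output_answer)"

text \<open>
  For the logarithmic cost, \<open>H k x\<close> says that numerator and denominator of \<open>x\<close> are bounded by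
  \<open>2 ^ k\<close>; for the uniform cost it is trivially true.
\<close>

locale weight =
  fixes wt :: "real \<Rightarrow> nat" and H :: "nat \<Rightarrow> real \<Rightarrow> bool"
  assumes H_mono: "H k x \<Longrightarrow> k \<le> l \<Longrightarrow> H l x"
    and H_0: "H k 0" and H_1: "H k 1"
    and H_arith: "H k x \<Longrightarrow> H l y \<Longrightarrow> H (k + l + 1) (apply_arith f x y)"
    and wt_le: "H k x \<Longrightarrow> wt x \<le> 2 * k + 3"
begin

lemma H_ariths:
  assumes "H k x" "H l y" "k + l + 1 \<le> h"
  shows "H h (x + y)" "H h (x - y)" "H h (x * y)" "H h (x / y)"
  using H_arith[OF assms(1,2), of Add] H_arith[OF assms(1,2), of Sub]
    H_arith[OF assms(1,2), of Mul] H_arith[OF assms(1,2), of Div] H_mono assms(3) by auto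

end

section \<open>Sizes of numbers and the elementary parts of the program\<close>

locale separation_run = covering m n D c + weight wt H
  for m n D c wt H +
  fixes L :: nat and Y :: "nat \<Rightarrow> real"
  assumes H_D: "i < m \<Longrightarrow> H L (D i)" and H_c: "j < n \<Longrightarrow> H L (c j)" and H_Y: "H L (Y j)"
    and Y_nonneg: "0 \<le> Y j"
begin

text \<open>Updating a machine price takes one product and one quotient with a gain, each adding
  \<open>L + 1\<close> to the height; hence the allowance \<open>2 * L + 2\<close> per move.
  \<open>X\<close> bounds the job prices, and \<open>M\<close> leaves one \<open>X\<close> per term
  for the accumulated right-hand side. An arithmetic operation touches three numbers of weight at
  most \<open>2 * M + 3\<close>, so it costs at most \<open>E = 1 + 3 * (2 * M + 3)\<close>.\<close>

definition X :: nat where "X = (m + n + 1) * (2 * L + 2)"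
definition M :: nat where "M = (m + n + 2) * X"
definition E :: nat where "E = 6 * M + 10"

lemma X_ge: "2 * L + 2 \<le> X" "L \<le> X" "L \<le> M" "X \<le> M" "X + X \<le> M"
  by (auto simp: X_def M_def algebra_simps)

abbreviation small :: "real \<Rightarrow> bool" where "small x \<equiv> H M x"

lemma E_ge: "10 \<le> E" by (simp add: E_def)

lemma terminates_Zero: "Q (put u 0 s) \<Longrightarrow> terminates wt (Assign u Zero) s E Q"
  using wt_le[OF H_0[of M]] by (intro terminates_Assign) (auto simp: E_def)

lemma terminates_One: "Q (put u 1 s) \<Longrightarrow> terminates wt (Assign u One) s E Q"
  using wt_le[OF H_1[of M]] by (intro terminates_Assign) (auto simp: E_def)

lemma terminates_Get:
  "small (get s v) \<Longrightarrow> Q (put u (get s v) s) \<Longrightarrow> terminates wt (Assign u (Get v)) s E Q"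
  using wt_le[of M "get s v"] by (intro terminates_Assign) (auto simp: E_def)

lemma terminates_Arith:
  assumes "small (get s v)" "small (get s v')" "small (apply_arith f (get s v) (get s v'))"
    and "Q (put u (apply_arith f (get s v) (get s v')) s)"
  shows "terminates wt (Assign u (Arith f v v')) s E Q"
  using wt_le[OF assms(1)] wt_le[OF assms(2)] wt_le[OF assms(3)] assms(4)
  by (intro terminates_Assign) (auto simp: E_def)

lemma RealLess_cost:
  assumes "small (get s u)" "small (get s v)"
  shows "test_cost wt (RealLess u v) s \<le> E"
  using wt_le[OF assms(1)] wt_le[OF assms(2)] by (auto simp: E_def)

lemma terminates_search:
  assumes regs: "dest \<noteq> 4" "len \<noteq> 4" "dest \<noteq> len"
    and small: "\<And>k. small (arr s a k)"
  shows "terminates wt (search a len dest) s (2 * (idx s len + 1) * E) (\<lambda>s'.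
    arr s' = arr s \<and> (\<forall>r. r \<noteq> dest \<and> r \<noteq> 4 \<longrightarrow> idx s' r = idx s r) \<and>
    idx s' dest \<le> idx s len \<and> (\<forall>k<idx s len. arr s a k \<le> arr s a (idx s' dest)) \<and>
    (idx s' dest = idx s len \<or> arr s a (idx s len) < arr s a (idx s' dest)))"
proof -
  define N where "N = idx s len"
  define I where "I v s' \<longleftrightarrow> arr s' = arr s \<and> (\<forall>r. r \<noteq> dest \<and> r \<noteq> 4 \<longrightarrow> idx s' r = idx s r) \<and>
    idx s' dest \<le> N \<and> v + idx s' 4 = N \<and> (\<forall>k<idx s' 4. arr s a k \<le> arr s a (idx s' dest)) \<and>
    (idx s' dest = N \<or> arr s a N < arr s a (idx s' dest))" for v and s' :: store
  let ?t = "IdxLess 4 len"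
  let ?p = "Seq (Cond (RealLess (a, dest) (a, 4)) (IdxCopy dest 4) Skip) (IdxIncr 4)"
  define s0 where "s0 = set_idx 4 0 (set_idx dest N s)"
  have loop: "terminates wt (While ?t ?p) s0 (N * (1 + (E + 1 + 1)) + 1)
    (\<lambda>s'. (\<exists>v. I v s') \<and> \<not> holds ?t s')"
  proof (rule terminates_While)
    show "I N s0" using regs by (auto simp: I_def s0_def set_idx_def N_def)
    show "test_cost wt ?t s' \<le> 1" for s' by simp
    fix v s' assume I: "I v s'" and "holds ?t s'"
    then have lt: "idx s' 4 < N" using regs by (auto simp: I_def N_def)
    then obtain v' where v': "v = Suc v'" using I by (cases v) (auto simp: I_def)
    have "terminates wt ?p s' (E + 1 + 1) (I v')"
    proof (intro terminates_Seq terminates_Cond)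
      show "test_cost wt (RealLess (a, dest) (a, 4)) s' \<le> E"
        using I small by (intro RealLess_cost) (auto simp: I_def)
      assume "holds (RealLess (a, dest) (a, 4)) s'"
      then have less: "arr s a (idx s' dest) < arr s a (idx s' 4)" using I by (simp add: I_def)
      have le: "arr s a k \<le> arr s a (idx s' 4)" if "k < Suc (idx s' 4)" for k
      proof (cases "k = idx s' 4")
        case False
        then have "arr s a k \<le> arr s a (idx s' dest)" using that I by (auto simp: I_def)
        then show ?thesis using less by simp
      qed simp
      have "arr s a N < arr s a (idx s' 4)" if "idx s' dest \<noteq> N"
        using that I less by (auto simp: I_def)
      moreover have "arr s a N < arr s a (idx s' 4)" if "idx s' dest = N"
        using that less by simp
      ultimately have lt': "arr s a N < arr s a (idx s' 4)" by blast
      have "I v' (set_idx 4 (Suc (idx s' 4)) (set_idx dest (idx s' 4) s'))"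
        using I lt lt' le regs v' by (simp add: I_def set_idx_def)
      then have "terminates wt (IdxIncr 4) (set_idx dest (idx s' 4) s') 1 (I v')"
        using regs by (intro terminates_IdxIncr) (simp_all add: set_idx_def)
      then show "terminates wt (IdxCopy dest 4) s' 1 (\<lambda>s'. terminates wt (IdxIncr 4) s' 1 (I v'))"
        by (intro terminates_IdxCopy) simp_all
    next
      assume "\<not> holds (RealLess (a, dest) (a, 4)) s'"
      then have "\<not> arr s a (idx s' dest) < arr s a (idx s' 4)" using I by (simp add: I_def)
      then have "I v' (set_idx 4 (Suc (idx s' 4)) s')"
        using I lt regs v' by (auto simp: I_def set_idx_def less_Suc_eq)
      then have "terminates wt (IdxIncr 4) s' 1 (I v')"
        by (intro terminates_IdxIncr) simp_all
      then show "terminates wt Skip s' 1 (\<lambda>s'. terminates wt (IdxIncr 4) s' 1 (I v'))"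
        by (intro terminates_Skip) simp_all
    qed
    then show "\<exists>v'<v. terminates wt ?p s' (E + 1 + 1) (I v')" using v' by blast
  qed
  have "terminates wt (search a len dest) s (1 + (1 + (N * (1 + (E + 1 + 1)) + 1)))
    (\<lambda>s'. (\<exists>v. I v s') \<and> \<not> holds ?t s')"
    unfolding search_def
    by (intro terminates_Seq terminates_IdxCopy terminates_IdxClear)
      (use loop in \<open>simp_all add: s0_def N_def\<close>)
  then show ?thesis
  proof (rule terminates_mono)
    have "N * 3 \<le> N * E" using E_ge by (intro mult_left_mono) auto
    show "1 + (1 + (N * (1 + (E + 1 + 1)) + 1)) \<le> 2 * (idx s len + 1) * E"
    proof -
      have "1 + (1 + (N * (1 + (E + 1 + 1)) + 1)) = N * E + N * 3 + 3"
        "2 * (idx s len + 1) * E = 2 * (N * E) + 2 * E"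
        by (simp_all add: N_def algebra_simps)
      then show ?thesis using \<open>N * 3 \<le> N * E\<close> E_ge by linarith
    qed
  qed (use regs in \<open>auto simp: I_def N_def not_less\<close>)
qed

lemma search_result:
  assumes a: "a = (\<lambda>k. if k < N \<and> k \<notin> S then f k else 0)"
    and q: "q \<le> N" "\<And>k. k < N \<Longrightarrow> a k \<le> a q" "q = N \<or> a N < a q"
    and pos: "\<And>k. k < N \<Longrightarrow> 0 < (f k :: real)"
  shows "q = N \<and> {..<N} \<subseteq> S \<or> greatest_on f ({..<N} - S) q"
proof (cases "q = N")
  case True
  then have "k \<in> S" if "k < N" for k
    using q(2)[OF that] pos[OF that] that unfolding a by (auto split: if_splits)
  then show ?thesis using True by auto
next
  case False
  then have "q < N" "q \<notin> S" using q by (auto simp: a split: if_splits)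
  moreover have "f k \<le> f q" if "k < N" "k \<notin> S" for k
    using q(2)[OF that(1)] that \<open>q < N\<close> \<open>q \<notin> S\<close> by (simp add: a)
  ultimately show ?thesis by (auto simp: greatest_on_def)
qed

lemma terminates_update_gain:
  assumes "small (get s (4, 5))" "small (get s (5, 5))"
    and "Q (put (6, 5) (min (get s (5, 5)) (get s (4, 5))) s)"
  shows "terminates wt update_gain s (E + E) Q"
  unfolding update_gain_def
proof (rule terminates_Cond)
  show "test_cost wt (RealLess (4, 5) (5, 5)) s \<le> E" using assms by (intro RealLess_cost)
  show "terminates wt (Assign (6, 5) (Get (4, 5))) s E Q" if "holds (RealLess (4, 5) (5, 5)) s"
    using that assms by (intro terminates_Get) (auto simp: min_def)
  show "terminates wt (Assign (6, 5) (Get (5, 5))) s E Q" if "\<not> holds (RealLess (4, 5) (5, 5)) s"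
    using that assms by (intro terminates_Get) (auto simp: min_def)
qed

lemma small_mono: "H k x \<Longrightarrow> k \<le> M \<Longrightarrow> small x"
  using H_mono by blast

text \<open>If no machine remains, \<open>q = m\<close> and the value read there is 0; the demand
  and gain then become 0 without a separate branch in the program.\<close>

lemma terminates_load_machine:
  assumes idx: "idx s 0 = m" "idx s 5 = 0"
    and arr0: "arr s 0 = (\<lambda>k. if k < m \<and> k \<notin> S then D k else 0)"
    and small: "small (arr s 5 0)"
  shows "terminates wt load_machine s (2 * (m + 1) * E + 5 * E) (\<lambda>s'. \<exists>q.
    (q = m \<and> {..<m} \<subseteq> S \<or> greatest_on D ({..<m} - S) q) \<and>
    idx s' 2 = q \<and> (\<forall>r. r \<noteq> 2 \<and> r \<noteq> 4 \<longrightarrow> idx s' r = idx s r) \<and>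
    arr s' 0 = (\<lambda>k. if k < m \<and> k \<notin> insert q S then D k else 0) \<and>
    arr s' 4 0 = (if q < m then D q else 0) \<and> arr s' 8 0 = (if q < m then D q else 0) \<and>
    arr s' 6 0 = min (arr s 5 0) (if q < m then D q else 0) \<and>
    (\<forall>a. a \<notin> {0, 4, 6, 8} \<longrightarrow> arr s' a = arr s a))" (is "terminates _ _ _ _ ?Q")
proof -
  have H0: "small (arr s 0 k)" for k
    using small_mono[OF H_D X_ge(3)] H_0 by (simp add: arr0)
  have "terminates wt load_machine s (2 * (m + 1) * E + (E + (E + (E + (E + E))))) ?Q"
    unfolding load_machine_def
  proof (rule terminates_Seq, rule terminates_mono, rule terminates_search)
    fix s1 :: store
    assume "arr s1 = arr s \<and> (\<forall>r. r \<noteq> 2 \<and> r \<noteq> 4 \<longrightarrow> idx s1 r = idx s r) \<and>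
      idx s1 2 \<le> idx s 0 \<and> (\<forall>k<idx s 0. arr s 0 k \<le> arr s 0 (idx s1 2)) \<and>
      (idx s1 2 = idx s 0 \<or> arr s 0 (idx s 0) < arr s 0 (idx s1 2))"
    then have s1: "arr s1 = arr s" "\<And>r. r \<noteq> 2 \<Longrightarrow> r \<noteq> 4 \<Longrightarrow> idx s1 r = idx s r"
      and q: "idx s1 2 \<le> m" "\<And>k. k < m \<Longrightarrow> arr s 0 k \<le> arr s 0 (idx s1 2)"
      "idx s1 2 = m \<or> arr s 0 m < arr s 0 (idx s1 2)"
      using idx by auto
    define q where "q = idx s1 2"
    have res: "q = m \<and> {..<m} \<subseteq> S \<or> greatest_on D ({..<m} - S) q"
      unfolding q_def by (rule search_result[OF arr0 q D_pos])
    then have val: "arr s 0 q = (if q < m then D q else 0)"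
      by (auto simp: arr0 greatest_on_def)
    have new: "(arr s 0)(q := 0) = (\<lambda>k. if k < m \<and> k \<notin> insert q S then D k else 0)"
      by (auto simp: arr0)
    show "terminates wt (Seq (Assign (4, 5) (Get (0, 2))) (Seq (Assign (0, 2) Zero)
        (Seq (Assign (8, 5) (Get (4, 5))) update_gain))) s1 (E + (E + (E + (E + E)))) ?Q"
      by (intro terminates_Seq terminates_Get terminates_Zero terminates_update_gain exI[of _ q])
        (use res small H0 in \<open>simp_all add: s1 idx q_def[symmetric] val[symmetric] new\<close>)
  qed (use H0 idx in auto)
  then show ?thesis by (rule terminates_mono) auto
qed

text \<open>The price product is assumed small for every \<open>l\<close>, since the type found by
  the search is not known in advance.\<close>

lemma terminates_load_job:
  assumes idx: "idx s 1 = n" "idx s 5 = 0"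
    and arr1: "arr s 1 = (\<lambda>k. if k < n \<and> k \<notin> S then c k else 0)" and arr2: "arr s 2 = Y"
    and small: "small (arr s 4 0)" "small (arr s 9 0)"
    and prod: "\<And>l. small (arr s 9 0 * min (if l < n then c l else 0) (arr s 4 0))"
  shows "terminates wt load_job s (2 * (n + 1) * E + 6 * E) (\<lambda>s'. \<exists>q.
    (q = n \<and> {..<n} \<subseteq> S \<or> greatest_on c ({..<n} - S) q) \<and>
    idx s' 3 = q \<and> (\<forall>r. r \<noteq> 3 \<and> r \<noteq> 4 \<longrightarrow> idx s' r = idx s r) \<and>
    arr s' 1 = (\<lambda>k. if k < n \<and> k \<notin> insert q S then c k else 0) \<and>
    arr s' 5 0 = (if q < n then c q else 0) \<and> arr s' 7 0 = Y q \<and>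
    arr s' 6 0 = min (if q < n then c q else 0) (arr s 4 0) \<and>
    arr s' 3 = (arr s 3)(q := arr s 9 0 * min (if q < n then c q else 0) (arr s 4 0)) \<and>
    (\<forall>a. a \<notin> {1, 3, 5, 6, 7} \<longrightarrow> arr s' a = arr s a))" (is "terminates _ _ _ _ ?Q")
proof -
  have H1: "small (arr s 1 k)" for k
    unfolding arr1 using small_mono[OF H_c X_ge(3)] H_0 by simp
  have HY: "small (Y k)" for k
    using small_mono[OF H_Y X_ge(3)] by simp
  have Hmin: "small (min (arr s 1 k) (arr s 4 0))" for k
    using H1 small by (simp add: min_def)
  have "terminates wt load_job s (2 * (n + 1) * E + (E + (E + (E + ((E + E) + E))))) ?Q"
    unfolding load_job_def
  proof (rule terminates_Seq, rule terminates_mono, rule terminates_search)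
    fix s1 :: store
    assume "arr s1 = arr s \<and> (\<forall>r. r \<noteq> 3 \<and> r \<noteq> 4 \<longrightarrow> idx s1 r = idx s r) \<and>
      idx s1 3 \<le> idx s 1 \<and> (\<forall>k<idx s 1. arr s 1 k \<le> arr s 1 (idx s1 3)) \<and>
      (idx s1 3 = idx s 1 \<or> arr s 1 (idx s 1) < arr s 1 (idx s1 3))"
    then have s1: "arr s1 = arr s" "\<And>r. r \<noteq> 3 \<Longrightarrow> r \<noteq> 4 \<Longrightarrow> idx s1 r = idx s r"
      and q: "idx s1 3 \<le> n" "\<And>k. k < n \<Longrightarrow> arr s 1 k \<le> arr s 1 (idx s1 3)"
      "idx s1 3 = n \<or> arr s 1 n < arr s 1 (idx s1 3)"
      using idx by (auto simp del: One_nat_def)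
    define q where "q = idx s1 3"
    have res: "q = n \<and> {..<n} \<subseteq> S \<or> greatest_on c ({..<n} - S) q"
      unfolding q_def by (rule search_result[OF arr1 q c_pos])
    then have val: "arr s 1 q = (if q < n then c q else 0)"
      by (auto simp: arr1 greatest_on_def simp del: One_nat_def)
    have new: "(arr s 1)(q := 0) = (\<lambda>k. if k < n \<and> k \<notin> insert q S then c k else 0)"
      by (auto simp: arr1 simp del: One_nat_def)
    have prod': "small (arr s 9 0 * min (arr s 1 q) (arr s 4 0))"
      unfolding val by (rule prod)
    show "terminates wt (Seq (Assign (5, 5) (Get (1, 3))) (Seq (Assign (1, 3) Zero)
        (Seq (Assign (7, 5) (Get (2, 3))) (Seq update_gain
        (Assign (3, 3) (Arith Mul (9, 5) (6, 5))))))) s1 (E + (E + (E + ((E + E) + E)))) ?Q"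
      by (intro terminates_Seq terminates_Get terminates_Zero terminates_update_gain
          terminates_Arith exI[of _ q])
        (use res small H1 HY Hmin prod' in
          \<open>simp_all add: s1 idx arr2 q_def[symmetric] val[symmetric] new del: One_nat_def\<close>)
  qed (use H1 idx in \<open>auto simp del: One_nat_def\<close>)
  then show ?thesis by (rule terminates_mono) auto
qed

end

section \<open>The loop invariant and the run of the program\<close>

context separation_run
begin

definition separates :: "(nat \<Rightarrow> real) \<Rightarrow> real \<Rightarrow> bool" where
  "separates y b \<longleftrightarrow> (\<forall>j<n. 0 < y j) \<and> (\<Sum>j<n. y j * Y j) < b \<and>
     (\<forall>x. fractional_cover x \<longrightarrow> b \<le> (\<Sum>j<n. y j * x j))"

lemma separates_cong:
  assumes "separates y b" "\<And>j. j < n \<Longrightarrow> y' j = y j"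
  shows "separates y' b"
proof -
  have "(\<Sum>j<n. y' j * x j) = (\<Sum>j<n. y j * x j)" for x
    using assms(2) by (intro sum.cong) auto
  then show ?thesis using assms unfolding separates_def by simp
qed

lemma greedy_failure_separates:
  assumes "greedy Y U i V j w y r d" "r * gain i j < d" "{..<n} \<subseteq> insert j V"
  shows "separates y (\<Sum>k\<in>insert i U. w k * D k)"
  using greedy_failure[OF assms] weak_duality[of _ w y]
  unfolding separates_def dual_feasible_def by auto

text \<open>
  One of the remaining supply (array 7) and the remaining demand (array 8) is always an input. Hence
  a step adds only a constant number of input heights to the sum of their heights, and no height is
  ever doubled.
\<close>

definition sized :: "nat \<Rightarrow> store \<Rightarrow> bool" where
  "sized e s \<longleftrightarrow>
     (\<exists>u v. u + v \<le> (e + 1) * (2 * L + 2) \<and> H u (arr s 7 0) \<and> H v (arr s 8 0)) \<and>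
     H (e * (2 * L + 2)) (arr s 9 0) \<and> H ((e + 1) * X) (arr s 10 0) \<and> (\<forall>k. H X (arr s 3 k))"

definition registers :: "store \<Rightarrow> bool" where
  "registers s \<longleftrightarrow> idx s 0 = m \<and> idx s 1 = n \<and> idx s 5 = 0"

text \<open>The function \<open>w\<close> as a whole lives only in the proof: the program keeps the
  price of the current machine, and earlier prices survive in the accumulated right-hand side. Array
  3 has to agree with \<open>y\<close> only on opened types.\<close>

definition running_with ::
    "nat set \<Rightarrow> nat set \<Rightarrow> (nat \<Rightarrow> real) \<Rightarrow> (nat \<Rightarrow> real) \<Rightarrow> nat \<Rightarrow> store \<Rightarrow> bool" where
  "running_with U V w y e s \<longleftrightarrow>
     greedy Y U (idx s 2) V (idx s 3) w y (arr s 7 0) (arr s 8 0) \<and> card U + card V = e \<and>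
     registers s \<and>
     arr s 0 = (\<lambda>k. if k < m \<and> k \<notin> insert (idx s 2) U then D k else 0) \<and>
     arr s 1 = (\<lambda>k. if k < n \<and> k \<notin> insert (idx s 3) V then c k else 0) \<and>
     arr s 2 = Y \<and> arr s 4 0 = D (idx s 2) \<and> arr s 5 0 = c (idx s 3) \<and>
     arr s 6 0 = gain (idx s 2) (idx s 3) \<and> arr s 9 0 = w (idx s 2) \<and>
     arr s 10 0 = (\<Sum>k\<in>insert (idx s 2) U. w k * D k) \<and>
     (\<forall>l\<in>insert (idx s 3) V. arr s 3 l = y l) \<and> sized e s"

definition finished :: "store \<Rightarrow> bool" where
  "finished s \<longleftrightarrow> registers s \<and> small (arr s 10 0) \<and> (\<forall>k. small (arr s 3 k)) \<and>
     (idx s 2 = m \<and> fractional_cover Y \<or>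
      idx s 2 < m \<and> idx s 3 = n \<and> separates (arr s 3) (arr s 10 0))"

text \<open>Here \<open>v\<close> bounds the moves still to come. A finished store may carry any
  \<open>v\<close>, because the loop test fails on it.\<close>

definition loop_inv :: "nat \<Rightarrow> store \<Rightarrow> bool" where
  "loop_inv v s \<longleftrightarrow> (\<exists>U V w y e. v + e = m + n \<and> running_with U V w y e s) \<or> finished s"

text \<open>The current machine and type lie outside \<open>U\<close> and \<open>V\<close>, so at
  most \<open>m + n - 2\<close> moves have been made. This slack makes room for the numbers computed
  in the next move.\<close>

lemma running_size:
  assumes "running_with U V w y e s"
  shows "e + 2 \<le> m + n" "e * (2 * L + 2) + (2 * L + 2) + (2 * L + 2) \<le> X"
    "(e + 1) * X + X \<le> M"
proof -
  have g: "greedy Y U (idx s 2) V (idx s 3) w y (arr s 7 0) (arr s 8 0)" "card U + card V = e"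
    using assms by (auto simp: running_with_def)
  note sorted = greedy_sorted[OF g(1)] and fin = greedy_finite[OF g(1)]
  have "card U + 1 \<le> m" "card V + 1 \<le> n"
    using sorted fin card_mono[of "{..<m}" "insert (idx s 2) U"]
      card_mono[of "{..<n}" "insert (idx s 3) V"] by auto
  then show e: "e + 2 \<le> m + n" using g(2) by simp
  have "(e + 2) * (2 * L + 2) \<le> (m + n + 1) * (2 * L + 2)"
    using e by (intro mult_right_mono) auto
  then show "e * (2 * L + 2) + (2 * L + 2) + (2 * L + 2) \<le> X"
    by (simp add: X_def algebra_simps)
  have "(e + 2) * X \<le> (m + n + 2) * X" using e by (intro mult_right_mono) auto
  then show "(e + 1) * X + X \<le> M" by (simp add: M_def algebra_simps)
qed

lemma H_gain: "i < m \<Longrightarrow> j < n \<Longrightarrow> H L (gain i j)"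
  using H_D H_c by (auto simp: gain_def min_def)

lemma terminates_change_job:
  assumes run: "running_with U V w y e s" and less: "arr s 7 0 * arr s 6 0 < arr s 8 0"
    and s1: "s1 = put (11, 5) (arr s 7 0 * arr s 6 0) s" and v: "Suc v + e = m + n"
  shows "terminates wt change_job s1 (E + (2 * (n + 1) * E + 6 * E)) (loop_inv v)"
proof -
  define i j r d where ijrd: "i = idx s 2" "j = idx s 3" "r = arr s 7 0" "d = arr s 8 0"
  note R = run[unfolded running_with_def registers_def sized_def, folded ijrd]
  have g: "greedy Y U i V j w y r d" using R by blast
  note sorted = greedy_sorted[OF g] and fin = greedy_finite[OF g]
  note num = running_size[OF run] X_ge
  obtain u u' where u: "u + u' \<le> (e + 1) * (2 * L + 2)" "H u r" "H u' d" using R by blast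
  have idx: "idx s 0 = m" "idx s 1 = n" "idx s 5 = 0" using R by auto
  have gij: "arr s 6 0 = gain i j" using R by blast
  have HA: "H L (gain i j)" using sorted H_gain by blast
  define t where "t = r * gain i j"
  have Ht: "H (u + L + 1) t" unfolding t_def using H_ariths(3)[OF u(2) HA order_refl] .
  define d' where "d' = d - t"
  \<comment> \<open>The heights of supply and demand merge in \<open>d'\<close>, with
    \<open>L + 2\<close> on top. The new supply is an input of height \<open>L\<close>, so their sum
    grows by \<open>2 * L + 2\<close> only.\<close>
  have Hd': "H (u + u' + L + 2) d'" unfolding d'_def by (rule H_ariths(2)[OF u(3) Ht]) simp
  have Hw: "H (e * (2 * L + 2)) (w i)" using R by auto
  have less': "t < d" using less by (simp add: t_def ijrd[symmetric] gij)
  define s2 where "s2 = put (8, 5) d' s1"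
  have s1': "idx s1 = idx s" "arr s1 = (arr s)(11 := (arr s 11)(0 := t))"
    by (simp_all add: s1 idx t_def ijrd[symmetric] gij)
  have s2: "idx s2 = idx s" "arr s2 = (arr s)(11 := (arr s 11)(0 := t), 8 := (arr s 8)(0 := d'))"
    by (simp_all add: s2_def s1' idx)
  have prod: "H X (w i * min (if l < n then c l else 0) (D i))" for l
  proof -
    have "H L (min (if l < n then c l else 0) (D i))"
      using H_c[of l] H_D[of i] H_0 sorted by (simp add: min_def)
    then show ?thesis by (rule H_ariths(3)[OF Hw]) (use num in simp)
  qed
  have job: "terminates wt load_job s2 (2 * (n + 1) * E + 6 * E) (loop_inv v)"
  proof (rule terminates_mono[OF terminates_load_job[where S = "insert j V"]])
    show "idx s2 1 = n" "idx s2 5 = 0" using idx by (simp_all add: s2 del: One_nat_def)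
    show "arr s2 1 = (\<lambda>k. if k < n \<and> k \<notin> insert j V then c k else 0)"
      using R by (simp add: s2 del: One_nat_def)
    show "arr s2 2 = Y" using R by (simp add: s2)
    show "small (arr s2 4 0)" using R small_mono[OF H_D num(6)] sorted by (simp add: s2)
    show "small (arr s2 9 0)" using R small_mono[OF Hw] num by (simp add: s2)
    show "small (arr s2 9 0 * min (if l < n then c l else 0) (arr s2 4 0))" for l
      using R small_mono[OF prod[of l]] num by (simp add: s2)
  next
    fix s3 :: store assume "\<exists>q. (q = n \<and> {..<n} \<subseteq> insert j V \<or> greatest_on c ({..<n} - insert j V) q) \<and>
      idx s3 3 = q \<and> (\<forall>r. r \<noteq> 3 \<and> r \<noteq> 4 \<longrightarrow> idx s3 r = idx s2 r) \<and>
      arr s3 1 = (\<lambda>k. if k < n \<and> k \<notin> insert q (insert j V) then c k else 0) \<and>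
      arr s3 5 0 = (if q < n then c q else 0) \<and> arr s3 7 0 = Y q \<and>
      arr s3 6 0 = min (if q < n then c q else 0) (arr s2 4 0) \<and>
      arr s3 3 = (arr s2 3)(q := arr s2 9 0 * min (if q < n then c q else 0) (arr s2 4 0)) \<and>
      (\<forall>a. a \<notin> {1, 3, 5, 6, 7} \<longrightarrow> arr s3 a = arr s2 a)"
    then obtain q where q: "q = n \<and> {..<n} \<subseteq> insert j V \<or> greatest_on c ({..<n} - insert j V) q"
      and loaded: "idx s3 3 = q" "\<And>r. r \<noteq> 3 \<Longrightarrow> r \<noteq> 4 \<Longrightarrow> idx s3 r = idx s2 r"
      "arr s3 1 = (\<lambda>k. if k < n \<and> k \<notin> insert q (insert j V) then c k else 0)"
      "arr s3 5 0 = (if q < n then c q else 0)" "arr s3 7 0 = Y q"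
      "arr s3 6 0 = min (if q < n then c q else 0) (arr s2 4 0)"
      "arr s3 3 = (arr s2 3)(q := arr s2 9 0 * min (if q < n then c q else 0) (arr s2 4 0))"
      "\<And>a. a \<notin> {1, 3, 5, 6, 7} \<Longrightarrow> arr s3 a = arr s2 a"
      by blast
    have cells: "arr s 4 0 = D i" "arr s 9 0 = w i" "arr s 2 = Y"
      "arr s 10 0 = (\<Sum>k\<in>insert i U. w k * D k)"
      using R by simp_all
    have s3: "idx s3 3 = q" "idx s3 0 = m" "idx s3 1 = n" "idx s3 5 = 0" "idx s3 2 = i"
      "arr s3 1 = (\<lambda>k. if k < n \<and> k \<notin> insert q (insert j V) then c k else 0)"
      "arr s3 5 0 = (if q < n then c q else 0)" "arr s3 7 0 = Y q"
      "arr s3 6 0 = min (if q < n then c q else 0) (D i)"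
      "arr s3 3 = (arr s 3)(q := w i * min (if q < n then c q else 0) (D i))"
      "arr s3 0 = arr s 0" "arr s3 2 = Y" "arr s3 4 0 = D i" "arr s3 8 0 = d'"
      "arr s3 9 0 = w i" "arr s3 10 0 = (\<Sum>k\<in>insert i U. w k * D k)"
      using idx by (simp_all add: loaded cells s2 ijrd[symmetric] del: One_nat_def)
    have H3: "H X (arr s3 3 k)" for k using R prod by (simp add: s3)
    have "H ((e + 1) * X) (arr s 10 0)" using R by blast
    then have H10: "H ((e + 1) * X) (arr s3 10 0)" by (simp only: s3 cells)
    from q show "loop_inv v s3"
    proof
      assume q: "q = n \<and> {..<n} \<subseteq> insert j V"
      have "separates y (\<Sum>k\<in>insert i U. w k * D k)"
        using greedy_failure_separates[OF g] less' q by (simp add: t_def)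
      \<comment> \<open>With \<open>q = n\<close> a price was also written to position
        \<open>n\<close> of array 3, but only positions below \<open>n\<close> matter.\<close>
      then have "separates (arr s3 3) (arr s3 10 0)"
        unfolding s3(16) by (rule separates_cong) (use q R s3 in auto)
      moreover have "small (arr s3 3 k)" for k using H3 num(7) by (rule small_mono)
      moreover have "small (arr s3 10 0)" using H10 by (rule small_mono) (use num in simp)
      ultimately have "finished s3" unfolding finished_def registers_def
        using q sorted by (simp add: s3(1-5) del: One_nat_def)
      then show ?thesis by (simp add: loop_inv_def)
    next
      assume q: "greatest_on c ({..<n} - insert j V) q"
      then have "q < n" "q \<notin> insert j V" by (auto simp: greatest_on_def)
      have "greedy Y U i (insert j V) q w (y(q := w i * gain i q)) (Y q) d'"
        using next_job[OF g _ q] less' by (simp add: t_def d'_def)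
      moreover have "sized (Suc e) s3" unfolding sized_def
      proof (intro conjI allI exI)
        show "L + (u + u' + L + 2) \<le> (Suc e + 1) * (2 * L + 2)" using u(1) by simp
        show "H L (arr s3 7 0)" using H_Y by (simp add: s3)
        show "H (u + u' + L + 2) (arr s3 8 0)" using Hd' by (simp add: s3)
        show "H (Suc e * (2 * L + 2)) (arr s3 9 0)" using H_mono[OF Hw] by (simp add: s3)
        show "H ((Suc e + 1) * X) (arr s3 10 0)" using H_mono[OF H10] by simp
      qed (rule H3)
      moreover have "card U + card (insert j V) = Suc e" using R sorted fin by simp
      ultimately have "running_with U (insert j V) w (y(q := w i * gain i q)) (Suc e) s3"
        unfolding running_with_def registers_def
        using R \<open>q < n\<close> \<open>q \<notin> insert j V\<close> by (auto simp: s3 gain_def simp del: One_nat_def)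
      then show ?thesis using v unfolding loop_inv_def by (metis add_Suc add_Suc_right)
    qed
  qed simp
  show ?thesis unfolding change_job_def
  proof (rule terminates_Seq, rule terminates_Arith)
    show "small (get s1 (8, 5))"
      using small_mono[OF u(3)] u(1) num by (simp add: s1' idx ijrd[symmetric])
    show "small (get s1 (11, 5))"
      using small_mono[OF Ht] u(1) num by (simp add: s1' idx)
    show "small (apply_arith Sub (get s1 (8, 5)) (get s1 (11, 5)))"
      using small_mono[OF Hd'] u(1) num by (simp add: s1' idx ijrd[symmetric] d'_def)
    show "terminates wt load_job (put (8, 5) (apply_arith Sub (get s1 (8, 5)) (get s1 (11, 5))) s1)
      (2 * (n + 1) * E + 6 * E) (loop_inv v)"
      using job by (simp add: s2_def s1' idx ijrd[symmetric] d'_def)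
  qed
qed

lemma terminates_change_machine:
  assumes run: "running_with U V w y e s" and not_less: "\<not> arr s 7 0 * arr s 6 0 < arr s 8 0"
    and s1: "s1 = put (11, 5) (arr s 7 0 * arr s 6 0) s" and v: "Suc v + e = m + n"
  shows "terminates wt change_machine s1 (E + (E + (E + ((2 * (m + 1) * E + 5 * E) + (E + (E + E))))))
    (loop_inv v)"
proof -
  define i j r d where ijrd: "i = idx s 2" "j = idx s 3" "r = arr s 7 0" "d = arr s 8 0"
  note R = run[unfolded running_with_def registers_def sized_def, folded ijrd]
  have g: "greedy Y U i V j w y r d" using R by blast
  note sorted = greedy_sorted[OF g] and fin = greedy_finite[OF g]
  note num = running_size[OF run] X_ge
  obtain u u' where u: "u + u' \<le> (e + 1) * (2 * L + 2)" "H u r" "H u' d" using R by blast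
  have idx: "idx s 0 = m" "idx s 1 = n" "idx s 5 = 0" using R by auto
  have gij: "arr s 6 0 = gain i j" using R by blast
  have HA: "H L (gain i j)" using sorted H_gain by blast
  have le: "d \<le> r * gain i j" using not_less by (simp add: ijrd[symmetric] gij)
  define t where "t = d / gain i j"
  have Ht: "H (u' + L + 1) t" unfolding t_def using H_ariths(4)[OF u(3) HA order_refl] .
  define r' where "r' = r - t"
  have Hr': "H (u + u' + L + 2) r'" unfolding r'_def by (rule H_ariths(2)[OF u(2) Ht]) simp
  have Hw: "H (e * (2 * L + 2)) (w i)" using R by auto
  define p where "p = w i * gain i j"
  have Hp: "H (e * (2 * L + 2) + L + 1) p" unfolding p_def using H_ariths(3)[OF Hw HA order_refl] .
  define s2 where "s2 = put (11, 5) p (put (7, 5) r' (put (11, 5) t s1))"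
  have s1': "idx s1 = idx s" "arr s1 = (arr s)(11 := (arr s 11)(0 := r * gain i j))"
    by (simp_all add: s1 idx ijrd[symmetric] gij)
  have s2: "idx s2 = idx s" "arr s2 = (arr s)(7 := (arr s 7)(0 := r'), 11 := (arr s 11)(0 := p))"
    by (auto simp: s2_def s1' idx fun_eq_iff)
  let ?step = "Seq (Assign (9, 5) (Arith Div (11, 5) (6, 5)))
    (Seq (Assign (11, 5) (Arith Mul (9, 5) (4, 5))) (Assign (10, 5) (Arith Add (10, 5) (11, 5))))"
  have mach: "terminates wt load_machine s2 (2 * (m + 1) * E + 5 * E)
    (\<lambda>s3. terminates wt ?step s3 (E + (E + E)) (loop_inv v))"
  proof (rule terminates_mono[OF terminates_load_machine[where S = "insert i U"]])
    show "idx s2 0 = m" "idx s2 5 = 0" using idx by (simp_all add: s2)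
    show "arr s2 0 = (\<lambda>k. if k < m \<and> k \<notin> insert i U then D k else 0)"
      using R by (simp add: s2)
    show "small (arr s2 5 0)" using R small_mono[OF H_c num(6)] sorted by (simp add: s2)
  next
    fix s3 :: store assume "\<exists>q. (q = m \<and> {..<m} \<subseteq> insert i U \<or> greatest_on D ({..<m} - insert i U) q) \<and>
      idx s3 2 = q \<and> (\<forall>r. r \<noteq> 2 \<and> r \<noteq> 4 \<longrightarrow> idx s3 r = idx s2 r) \<and>
      arr s3 0 = (\<lambda>k. if k < m \<and> k \<notin> insert q (insert i U) then D k else 0) \<and>
      arr s3 4 0 = (if q < m then D q else 0) \<and> arr s3 8 0 = (if q < m then D q else 0) \<and>
      arr s3 6 0 = min (arr s2 5 0) (if q < m then D q else 0) \<and>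
      (\<forall>a. a \<notin> {0, 4, 6, 8} \<longrightarrow> arr s3 a = arr s2 a)"
    then obtain q where q: "q = m \<and> {..<m} \<subseteq> insert i U \<or> greatest_on D ({..<m} - insert i U) q"
      and loaded: "idx s3 2 = q" "\<And>r. r \<noteq> 2 \<Longrightarrow> r \<noteq> 4 \<Longrightarrow> idx s3 r = idx s2 r"
      "arr s3 0 = (\<lambda>k. if k < m \<and> k \<notin> insert q (insert i U) then D k else 0)"
      "arr s3 4 0 = (if q < m then D q else 0)" "arr s3 8 0 = (if q < m then D q else 0)"
      "arr s3 6 0 = min (arr s2 5 0) (if q < m then D q else 0)"
      "\<And>a. a \<notin> {0, 4, 6, 8} \<Longrightarrow> arr s3 a = arr s2 a"
      by blast
    have cells: "arr s 5 0 = c j" "arr s 2 = Y" "arr s 10 0 = (\<Sum>k\<in>insert i U. w k * D k)"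
      using R by simp_all
    have s3: "idx s3 2 = q" "idx s3 0 = m" "idx s3 1 = n" "idx s3 5 = 0" "idx s3 3 = j"
      "arr s3 0 = (\<lambda>k. if k < m \<and> k \<notin> insert q (insert i U) then D k else 0)"
      "arr s3 4 0 = (if q < m then D q else 0)" "arr s3 8 0 = (if q < m then D q else 0)"
      "arr s3 6 0 = min (c j) (if q < m then D q else 0)"
      "arr s3 1 = arr s 1" "arr s3 2 = Y" "arr s3 3 = arr s 3" "arr s3 5 0 = c j" "arr s3 7 0 = r'"
      "arr s3 10 0 = (\<Sum>k\<in>insert i U. w k * D k)" "arr s3 11 0 = p"
      using idx by (simp_all add: loaded cells s2 ijrd[symmetric] del: One_nat_def)
    \<comment> \<open>If no machine is left, the new gain is 0 and the division yields 0, so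
      \<open>b\<close> is the old right-hand side.\<close>
    define w' where "w' = p / arr s3 6 0"
    define b where "b = arr s3 10 0 + w' * arr s3 4 0"
    have HDq: "H L (arr s3 4 0)" using H_D H_0 by (simp add: s3)
    have H6: "H L (arr s3 6 0)" using H_D H_c[of j] H_0 sorted by (auto simp: s3 min_def)
    have Hw': "H (Suc e * (2 * L + 2)) w'"
      unfolding w'_def by (rule H_ariths(4)[OF Hp H6]) simp
    have HwD: "H (Suc e * (2 * L + 2) + L + 1) (w' * arr s3 4 0)"
      by (rule H_ariths(3)[OF Hw' HDq]) simp
    have "H ((e + 1) * X) (arr s 10 0)" using R by blast
    then have H10: "H ((e + 1) * X) (arr s3 10 0)" by (simp only: s3 cells)
    have Hb: "H ((Suc e + 1) * X) b" unfolding b_def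
      by (rule H_ariths(1)[OF H10 HwD]) (use num in simp)
    define s4 where "s4 = put (10, 5) b (put (11, 5) (w' * arr s3 4 0) (put (9, 5) w' s3))"
    have s4: "idx s4 = idx s3" "arr s4 = (arr s3)(9 := (arr s3 9)(0 := w'),
        10 := (arr s3 10)(0 := b), 11 := (arr s3 11)(0 := w' * arr s3 4 0))"
      by (auto simp: s4_def s3 fun_eq_iff)
    have H3: "H X (arr s3 3 k)" for k using R by (simp add: s3)
    have "loop_inv v s4"
      using q
    proof
      assume q: "q = m \<and> {..<m} \<subseteq> insert i U"
      have "fractional_cover Y" using greedy_success[OF g Y_nonneg le] q by blast
      moreover have "small b" using small_mono[OF Hb] num by simp
      moreover have "small (arr s3 3 k)" for k using H3 num(7) by (rule small_mono)
      ultimately have "finished s4" unfolding finished_def registers_def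
        using q by (simp add: s4 s3(1-5) del: One_nat_def)
      then show ?thesis by (simp add: loop_inv_def)
    next
      assume q: "greatest_on D ({..<m} - insert i U) q"
      then have qm: "q < m" "q \<notin> insert i U" by (auto simp: greatest_on_def)
      have w': "w' = w i * gain i j / gain q j" using qm by (simp add: w'_def p_def s3 gain_def)
      have "greedy Y (insert i U) q V j (w(q := w')) y r' (D q)"
        using next_machine[OF g le q] by (simp add: w' r'_def t_def)
      moreover have "sized (Suc e) s4" unfolding sized_def
      proof (intro conjI allI exI)
        show "(u + u' + L + 2) + L \<le> (Suc e + 1) * (2 * L + 2)" using u(1) by simp
        show "H (u + u' + L + 2) (arr s4 7 0)" using Hr' by (simp add: s4 s3)
        show "H L (arr s4 8 0)" using H_D H_0 by (simp add: s4 s3)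
        show "H (Suc e * (2 * L + 2)) (arr s4 9 0)" using Hw' by (simp add: s4)
        show "H ((Suc e + 1) * X) (arr s4 10 0)" using Hb by (simp add: s4)
        show "H X (arr s4 3 k)" for k using H3 by (simp add: s4)
      qed
      moreover have "card (insert i U) + card V = Suc e" using R sorted fin by simp
      moreover have "b = (\<Sum>k\<in>insert q (insert i U). (w(q := w')) k * D k)"
        using sum_insert_update[of "insert i U" q D w w'] qm fin
        by (simp add: b_def s3 mult.commute)
      moreover have "arr s4 6 0 = gain q j" using qm by (simp add: s4 s3 gain_def)
      ultimately have "running_with (insert i U) V (w(q := w')) y (Suc e) s4"
        unfolding running_with_def registers_def
        using R qm by (simp add: s4 s3 ijrd[symmetric] del: One_nat_def)
      then show ?thesis using v unfolding loop_inv_def by (metis add_Suc add_Suc_right)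
    qed
    moreover have "small (arr s3 4 0)" "small (arr s3 6 0)" "small p" "small w'"
      "small (w' * arr s3 4 0)" "small (arr s3 10 0)" "small b"
      using HDq H6 Hp Hw' HwD H10 Hb num by (auto intro: small_mono)
    ultimately show "terminates wt ?step s3 (E + (E + E)) (loop_inv v)"
      by (intro terminates_Seq terminates_Arith)
        (simp_all add: s3(4,16) w'_def[symmetric] b_def[symmetric] s4_def)
  qed simp
  have small: "small r" "small d" "small (gain i j)" "small t" "small r'" "small (w i)" "small p"
    using u num small_mono[OF u(2)] small_mono[OF u(3)] small_mono[OF HA] small_mono[OF Ht]
      small_mono[OF Hr'] small_mono[OF Hw] small_mono[OF Hp] by auto
  have cells: "arr s 8 0 = d" "arr s 7 0 = r" "arr s 6 0 = gain i j" "arr s 9 0 = w i"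
    using R ijrd by auto
  show ?thesis unfolding change_machine_def
    using small mach
    by (intro terminates_Seq terminates_Arith)
      (simp_all add: s1' idx cells t_def[symmetric] r'_def[symmetric] p_def[symmetric] s2_def)
qed

lemma terminates_main_loop:
  assumes "loop_inv (m + n) s"
  shows "terminates wt main_loop s
    ((m + n) * (3 + (E + (E + (2 * (m + n + 1) * E + 13 * E)))) + 3) finished"
proof -
  let ?t = "Conj (IdxLess 2 0) (IdxLess 3 1)"
  let ?p = "Seq (Assign (11, 5) (Arith Mul (7, 5) (6, 5)))
    (Cond (RealLess (11, 5) (8, 5)) change_job change_machine)"
  have "terminates wt (While ?t ?p) s
    ((m + n) * (3 + (E + (E + (2 * (m + n + 1) * E + 13 * E)))) + 3)
    (\<lambda>s'. (\<exists>v. loop_inv v s') \<and> \<not> holds ?t s')"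
  proof (rule terminates_While)
    show "test_cost wt ?t s \<le> 3" for s by simp
    fix v s assume inv: "loop_inv v s" and cond: "holds ?t s"
    have "\<not> finished s" using cond by (auto simp: finished_def registers_def separates_def)
    then obtain U V w y e where run: "running_with U V w y e s" and e: "v + e = m + n"
      using inv unfolding loop_inv_def by blast
    note num = running_size[OF run] X_ge
    from e num(1) obtain v' where v': "v = Suc v'" "Suc v' + e = m + n" by (cases v) auto
    note R = run[unfolded running_with_def registers_def sized_def]
    have g: "greedy Y U (idx s 2) V (idx s 3) w y (arr s 7 0) (arr s 8 0)" using R by blast
    obtain u u' where u: "u + u' \<le> (e + 1) * (2 * L + 2)" "H u (arr s 7 0)" "H u' (arr s 8 0)"
      using R by blast
    have A: "H L (arr s 6 0)" using R greedy_sorted[OF g] H_gain by auto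
    have small: "small (arr s 7 0)" "small (arr s 8 0)" "small (arr s 6 0)"
      "small (arr s 7 0 * arr s 6 0)"
      using u num small_mono[OF u(2)] small_mono[OF u(3)] small_mono[OF A]
        small_mono[OF H_ariths(3)[OF u(2) A order_refl]] by auto
    define s1 where "s1 = put (11, 5) (arr s 7 0 * arr s 6 0) s"
    have r5: "idx s 5 = 0" using R by blast
    have "terminates wt (Cond (RealLess (11, 5) (8, 5)) change_job change_machine) s1
      (E + (2 * (m + n + 1) * E + 13 * E)) (loop_inv v')"
    proof (rule terminates_Cond)
      show "test_cost wt (RealLess (11, 5) (8, 5)) s1 \<le> E"
        by (rule RealLess_cost) (use small in \<open>simp_all add: s1_def r5\<close>)
      have holds: "holds (RealLess (11, 5) (8, 5)) s1 \<longleftrightarrow> arr s 7 0 * arr s 6 0 < arr s 8 0"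
        by (simp add: s1_def r5)
      show "terminates wt change_job s1 (2 * (m + n + 1) * E + 13 * E) (loop_inv v')"
        if "holds (RealLess (11, 5) (8, 5)) s1"
        using terminates_change_job[OF run _ s1_def v'(2)] that holds
        by (auto elim!: terminates_mono simp: algebra_simps)
      show "terminates wt change_machine s1 (2 * (m + n + 1) * E + 13 * E) (loop_inv v')"
        if "\<not> holds (RealLess (11, 5) (8, 5)) s1"
        using terminates_change_machine[OF run _ s1_def v'(2)] that holds
        by (auto elim!: terminates_mono simp: algebra_simps)
    qed
    then have "terminates wt ?p s (E + (E + (2 * (m + n + 1) * E + 13 * E))) (loop_inv v')"
      using small by (intro terminates_Seq terminates_Arith) (simp_all add: r5 s1_def)
    then show "\<exists>v'<v. terminates wt ?p s (E + (E + (2 * (m + n + 1) * E + 13 * E))) (loop_inv v')"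
      using v' by blast
  qed (rule assms)
  then show ?thesis unfolding main_loop_def
  proof (rule terminates_mono)
    fix s' assume s': "(\<exists>v. loop_inv v s') \<and> \<not> holds ?t s'"
    \<comment> \<open>A running greedy state has both current indices in range, so the loop test
      would still hold.\<close>
    have "\<not> running_with U V w y e s'" for U V w y e
    proof
      assume run: "running_with U V w y e s'"
      then have "greedy Y U (idx s' 2) V (idx s' 3) w y (arr s' 7 0) (arr s' 8 0)" "registers s'"
        unfolding running_with_def by blast+
      then show False using greedy_sorted[of Y U "idx s' 2" V "idx s' 3"] s'
        unfolding registers_def by fastforce
    qed
    then show "finished s'" using s' unfolding loop_inv_def by blast
  qed simp
qed

definition correct_output :: "store \<Rightarrow> bool" where
  "correct_output s \<longleftrightarrow>
     (if idx s 0 = 0 then fractional_cover Y else separates (arr s 0) (arr s 1 0))"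

lemma terminates_output_answer:
  assumes fin: "finished s"
  shows "terminates wt output_answer s (1 + (1 + ((n * (1 + (E + 1)) + 1) + E))) correct_output"
proof -
  have reg: "idx s 0 = m" "idx s 1 = n" "idx s 5 = 0" and small: "small (arr s 10 0)" "\<And>k. small (arr s 3 k)"
    and res: "idx s 2 = m \<and> fractional_cover Y \<or>
      idx s 2 < m \<and> idx s 3 = n \<and> separates (arr s 3) (arr s 10 0)"
    using fin by (auto simp: finished_def registers_def)
  show ?thesis unfolding output_answer_def
  proof (rule terminates_Cond)
    show "test_cost wt (IdxLess 2 0) s \<le> 1" by simp
    assume "\<not> holds (IdxLess 2 0) s"
    then have "fractional_cover Y" using res reg by auto
    then show "terminates wt (IdxClear 0) s (1 + ((n * (1 + (E + 1)) + 1) + E)) correct_output"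
      by (intro terminates_IdxClear) (simp_all add: correct_output_def set_idx_def)
  next
    assume "holds (IdxLess 2 0) s"
    then have sep: "separates (arr s 3) (arr s 10 0)" and m: "0 < m" using res reg by auto
    let ?p = "Seq (Assign (0, 4) (Get (3, 4))) (IdxIncr 4)"
    define I where "I v s' \<longleftrightarrow> (\<forall>r. r \<noteq> 4 \<longrightarrow> idx s' r = idx s r) \<and> v + idx s' 4 = n \<and>
      arr s' 3 = arr s 3 \<and> arr s' 10 = arr s 10 \<and> (\<forall>k<idx s' 4. arr s' 0 k = arr s 3 k)"
      for v and s' :: store
    define s0 where "s0 = set_idx 4 0 s"
    have "terminates wt (While (IdxLess 4 1) ?p) s0 (n * (1 + (E + 1)) + 1)
      (\<lambda>s'. (\<exists>v. I v s') \<and> \<not> holds (IdxLess 4 1) s')"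
    proof (rule terminates_While)
      show "I n s0" by (simp add: I_def s0_def set_idx_def)
      show "test_cost wt (IdxLess 4 1) s' \<le> 1" for s' by simp
      fix v s' assume I: "I v s'" and "holds (IdxLess 4 1) s'"
      then have lt: "idx s' 4 < n" using reg by (simp add: I_def del: One_nat_def)
      then obtain v' where v': "v = Suc v'" using I by (cases v) (auto simp: I_def)
      define s1 where "s1 = put (0, 4) (arr s' 3 (idx s' 4)) s'"
      have "I v' (set_idx 4 (Suc (idx s1 4)) s1)"
        using I v' by (auto simp: I_def s1_def set_idx_def less_Suc_eq)
      then have "terminates wt (IdxIncr 4) s1 1 (I v')"
        by (intro terminates_IdxIncr) simp_all
      moreover have "small (arr s' 3 (idx s' 4))" using I small by (simp add: I_def)
      ultimately have "terminates wt ?p s' (E + 1) (I v')"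
        by (intro terminates_Seq terminates_Get) (simp_all add: s1_def)
      then show "\<exists>v'<v. terminates wt ?p s' (E + 1) (I v')" using v' by blast
    qed
    then have loop: "terminates wt (While (IdxLess 4 1) ?p) s0 (n * (1 + (E + 1)) + 1)
      (\<lambda>s'. terminates wt (Assign (1, 5) (Get (10, 5))) s' E correct_output)"
    proof (rule terminates_mono)
      fix s' assume s': "(\<exists>v. I v s') \<and> \<not> holds (IdxLess 4 1) s'"
      then obtain v where I: "I v s'" by blast
      have regs': "idx s' 0 = m" "idx s' 1 = n" "idx s' 5 = 0" using I reg by (auto simp: I_def)
      have "idx s' 4 = n" using s' regs' I by (auto simp: I_def simp del: One_nat_def)
      then have "separates (arr s' 0) (arr s 10 0)"
        using I by (intro separates_cong[OF sep]) (simp add: I_def)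
      moreover have "arr s' 10 = arr s 10" using I by (simp add: I_def)
      ultimately have "correct_output (put (1, 5) (arr s' 10 0) s')"
        using m regs' by (simp add: correct_output_def)
      then show "terminates wt (Assign (1, 5) (Get (10, 5))) s' E correct_output"
        using small(1) regs' \<open>arr s' 10 = arr s 10\<close> by (intro terminates_Get) simp_all
    qed simp
    show "terminates wt (Seq (IdxClear 4) (Seq (While (IdxLess 4 1) ?p) (Assign (1, 5) (Get (10, 5)))))
      s (1 + ((n * (1 + (E + 1)) + 1) + E)) correct_output"
      by (rule terminates_Seq, rule terminates_IdxClear, rule order_refl)
        (rule terminates_Seq[OF loop[unfolded s0_def]])
  qed
qed

lemma terminates_initialize:
  assumes reg: "idx s 0 = m" "idx s 1 = n" "idx s 5 = 0"
    and arr: "arr s 0 = (\<lambda>k. if k < m then D k else 0)" "arr s 1 = (\<lambda>k. if k < n then c k else 0)"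
      "arr s 2 = Y" "arr s 3 = (\<lambda>_. 0)" "arr s 5 = (\<lambda>_. 0)"
  shows "terminates wt initialize s
    ((2 * (m + 1) * E + 5 * E) + (E + (E + (2 * (n + 1) * E + 6 * E)))) (loop_inv (m + n))"
  unfolding initialize_def
proof (rule terminates_Seq, rule terminates_mono[OF terminates_load_machine[where S = "{}"]])
  fix s1 :: store assume "\<exists>q. (q = m \<and> {..<m} \<subseteq> {} \<or> greatest_on D ({..<m} - {}) q) \<and>
    idx s1 2 = q \<and> (\<forall>r. r \<noteq> 2 \<and> r \<noteq> 4 \<longrightarrow> idx s1 r = idx s r) \<and>
    arr s1 0 = (\<lambda>k. if k < m \<and> k \<notin> insert q {} then D k else 0) \<and>
    arr s1 4 0 = (if q < m then D q else 0) \<and> arr s1 8 0 = (if q < m then D q else 0) \<and>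
    arr s1 6 0 = min (arr s 5 0) (if q < m then D q else 0) \<and>
    (\<forall>a. a \<notin> {0, 4, 6, 8} \<longrightarrow> arr s1 a = arr s a)"
  then obtain i where i: "i = m \<and> m = 0 \<or> greatest_on D {..<m} i"
    and loaded: "idx s1 2 = i" "\<And>r. r \<noteq> 2 \<Longrightarrow> r \<noteq> 4 \<Longrightarrow> idx s1 r = idx s r"
    "arr s1 0 = (\<lambda>k. if k < m \<and> k \<notin> insert i {} then D k else 0)"
    "arr s1 4 0 = (if i < m then D i else 0)" "arr s1 8 0 = (if i < m then D i else 0)"
    "\<And>a. a \<notin> {0, 4, 6, 8} \<Longrightarrow> arr s1 a = arr s a"
    unfolding Diff_empty subset_empty lessThan_empty_iff by (auto simp: bot_nat_def)
  define Di where "Di = (if i < m then D i else 0)"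
  have H: "H L Di" using H_D H_0 by (simp add: Di_def)
  define s2 where "s2 = put (10, 5) Di (put (9, 5) 1 s1)"
  have s1: "idx s1 2 = i" "idx s1 0 = m" "idx s1 1 = n" "idx s1 5 = 0"
    using loaded reg by (simp_all del: One_nat_def)
  have s2: "idx s2 = idx s1" "arr s2 = (arr s1)(9 := (arr s1 9)(0 := 1), 10 := (arr s1 10)(0 := Di))"
    by (auto simp: s2_def s1 fun_eq_iff)
  have val: "arr s2 0 = (\<lambda>k. if k < m \<and> k \<noteq> i then D k else 0)" "arr s2 1 = (\<lambda>k. if k < n then c k else 0)"
    "arr s2 2 = Y" "arr s2 3 = (\<lambda>_. 0)" "arr s2 4 0 = Di" "arr s2 8 0 = Di" "arr s2 9 0 = 1" "arr s2 10 0 = Di"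
    using loaded arr by (simp_all add: s2 Di_def del: One_nat_def)
  have Hmin: "H L (min (if l < n then c l else 0) Di)" for l
    using H H_c[of l] H_0 by (simp add: min_def)
  have job: "terminates wt load_job s2 (2 * (n + 1) * E + 6 * E) (loop_inv (m + n))"
  proof (rule terminates_mono[OF terminates_load_job[where S = "{}"]])
    show "idx s2 1 = n" "idx s2 5 = 0" using s1 by (simp_all add: s2 del: One_nat_def)
    show "arr s2 1 = (\<lambda>k. if k < n \<and> k \<notin> {} then c k else 0)" using val by simp
    show "arr s2 2 = Y" by (rule val)
    show "small (arr s2 4 0)" using small_mono[OF H X_ge(3)] by (simp add: val)
    show "small (arr s2 9 0)" using H_1 by (simp add: val)
    show "small (arr s2 9 0 * min (if l < n then c l else 0) (arr s2 4 0))" for l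
      using small_mono[OF Hmin[of l] X_ge(3)] by (simp add: val)
  next
    fix s3 :: store assume "\<exists>q. (q = n \<and> {..<n} \<subseteq> {} \<or> greatest_on c ({..<n} - {}) q) \<and>
      idx s3 3 = q \<and> (\<forall>r. r \<noteq> 3 \<and> r \<noteq> 4 \<longrightarrow> idx s3 r = idx s2 r) \<and>
      arr s3 1 = (\<lambda>k. if k < n \<and> k \<notin> insert q {} then c k else 0) \<and>
      arr s3 5 0 = (if q < n then c q else 0) \<and> arr s3 7 0 = Y q \<and>
      arr s3 6 0 = min (if q < n then c q else 0) (arr s2 4 0) \<and>
      arr s3 3 = (arr s2 3)(q := arr s2 9 0 * min (if q < n then c q else 0) (arr s2 4 0)) \<and>
      (\<forall>a. a \<notin> {1, 3, 5, 6, 7} \<longrightarrow> arr s3 a = arr s2 a)"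
    then obtain j where j: "j = n \<and> n = 0 \<or> greatest_on c {..<n} j"
      and loaded: "idx s3 3 = j" "\<And>r. r \<noteq> 3 \<Longrightarrow> r \<noteq> 4 \<Longrightarrow> idx s3 r = idx s2 r"
      "arr s3 1 = (\<lambda>k. if k < n \<and> k \<notin> insert j {} then c k else 0)"
      "arr s3 5 0 = (if j < n then c j else 0)" "arr s3 7 0 = Y j"
      "arr s3 6 0 = min (if j < n then c j else 0) (arr s2 4 0)"
      "arr s3 3 = (arr s2 3)(j := arr s2 9 0 * min (if j < n then c j else 0) (arr s2 4 0))"
      "\<And>a. a \<notin> {1, 3, 5, 6, 7} \<Longrightarrow> arr s3 a = arr s2 a"
      unfolding Diff_empty subset_empty lessThan_empty_iff by (auto simp: bot_nat_def)
    have s3: "idx s3 2 = i" "idx s3 0 = m" "idx s3 1 = n" "idx s3 5 = 0"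
      "arr s3 0 = (\<lambda>k. if k < m \<and> k \<noteq> i then D k else 0)" "arr s3 2 = Y"
      "arr s3 3 = (\<lambda>_. 0)(j := min (if j < n then c j else 0) Di)"
      "arr s3 6 0 = min (if j < n then c j else 0) Di"
      "arr s3 4 0 = Di" "arr s3 8 0 = Di" "arr s3 9 0 = 1" "arr s3 10 0 = Di"
      using s1 by (simp_all add: loaded val s2(1) del: One_nat_def)
    have H3: "H L (arr s3 3 k)" for k using Hmin[of j] H_0 by (simp add: s3)
    have small3: "small (arr s3 10 0)" "small (arr s3 3 k)" for k
      using small_mono[OF H X_ge(3)] small_mono[OF H3 X_ge(3)] s3(12) by auto
    \<comment> \<open>The greedy procedure starts only in the last case. Without machines every
      non-negative supply covers; without job types none does, and \<open>D i > 0\<close> exceeds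
      the empty sum.\<close>
    consider "m = 0" | "0 < m" "n = 0" | "0 < m" "0 < n" by auto
    then show "loop_inv (m + n) s3"
    proof cases
      case 1
      then have "fractional_cover Y" unfolding fractional_cover_def using Y_nonneg by simp
      moreover have "i = m" using i 1 by (auto simp: greatest_on_def)
      ultimately have "finished s3" using small3 s3 by (simp add: finished_def registers_def)
      then show ?thesis by (simp add: loop_inv_def)
    next
      case 2
      then have i: "greatest_on D {..<m} i" and j: "j = n" using i j by (auto simp: greatest_on_def)
      then have im: "i < m" by (simp add: greatest_on_def)
      have no: "\<not> fractional_cover x" for x
      proof
        assume "fractional_cover x"
        then have "D i \<le> 0" unfolding fractional_cover_def using 2 im by auto
        then show False using D_pos[OF im] by simp
      qed
      have "separates (arr s3 3) (arr s3 10 0)" unfolding separates_def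
        using no D_pos[OF im] im 2 by (simp add: s3 Di_def)
      then have "finished s3" using small3 s3 im loaded(1) j by (simp add: finished_def registers_def)
      then show ?thesis by (simp add: loop_inv_def)
    next
      case 3
      then have i: "greatest_on D {..<m} i" and j: "greatest_on c {..<n} j" using i j by auto
      then have lt: "i < m" "j < n" by (simp_all add: greatest_on_def)
      have g: "greedy Y {} i {} j ((\<lambda>_. 0)(i := 1)) ((\<lambda>_. 0)(j := gain i j)) (Y j) (D i)"
        by (rule start[OF i j])
      have sz: "sized 0 s3" unfolding sized_def
      proof (intro conjI allI exI)
        show "L + L \<le> (0 + 1) * (2 * L + 2)" by simp
        show "H L (arr s3 7 0)" using H_Y by (simp add: loaded)
        show "H L (arr s3 8 0)" using H by (simp add: s3)
        show "H (0 * (2 * L + 2)) (arr s3 9 0)" using H_1 by (simp add: s3)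
        show "H ((0 + 1) * X) (arr s3 10 0)" using H_mono[OF H X_ge(2)] by (simp add: s3)
        show "H X (arr s3 3 k)" for k by (rule H_mono[OF H3 X_ge(2)])
      qed
      have "running_with {} {} ((\<lambda>_. 0)(i := 1)) ((\<lambda>_. 0)(j := gain i j)) 0 s3"
        unfolding running_with_def registers_def
        using g sz lt by (simp add: s3 loaded(1,3-5) Di_def gain_def del: One_nat_def)
      then show ?thesis unfolding loop_inv_def by (intro disjI1 exI conjI) auto
    qed
  qed simp
  have "small (arr s1 4 0)" using small_mono[OF H X_ge(3)] loaded(4) by (simp add: Di_def)
  then show "terminates wt (Seq (Assign (9, 5) One) (Seq (Assign (10, 5) (Get (4, 5))) load_job)) s1
    (E + (E + (2 * (n + 1) * E + 6 * E))) (loop_inv (m + n))"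
    using job loaded(4)
    by (intro terminates_Seq terminates_One terminates_Get) (simp_all add: s1 s2_def Di_def)
qed (use reg arr H_0 in simp_all)

lemma terminates_separation_program:
  assumes reg: "idx s 0 = m" "idx s 1 = n" "idx s 5 = 0"
    and arr: "arr s 0 = (\<lambda>k. if k < m then D k else 0)" "arr s 1 = (\<lambda>k. if k < n then c k else 0)"
      "arr s 2 = Y" "arr s 3 = (\<lambda>_. 0)" "arr s 5 = (\<lambda>_. 0)"
  shows "terminates wt separation_program s (60 * (m + n + 1) ^ 2 * E) correct_output"
proof -
  let ?init = "(2 * (m + 1) * E + 5 * E) + (E + (E + (2 * (n + 1) * E + 6 * E)))"
  let ?main = "(m + n) * (3 + (E + (E + (2 * (m + n + 1) * E + 13 * E)))) + 3"
  let ?out = "1 + (1 + ((n * (1 + (E + 1)) + 1) + E))"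
  have "terminates wt separation_program s (?init + (?main + ?out)) correct_output"
    unfolding separation_program_def
  proof (rule terminates_Seq, rule terminates_mono[OF terminates_initialize[OF assms] order_refl])
    fix s1 assume "loop_inv (m + n) s1"
    then show "terminates wt (Seq main_loop output_answer) s1 (?main + ?out) correct_output"
      by (intro terminates_Seq terminates_mono[OF terminates_main_loop order_refl]
          terminates_output_answer)
  qed
  then show ?thesis
  proof (rule terminates_mono)
    define T where "T = m + n + 1"
    have T: "m + 1 \<le> T" "n + 1 \<le> T" "m + n \<le> T" "1 \<le> T" by (auto simp: T_def)
    have TE: "T * E \<le> T * T * E" "E \<le> T * T * E" using T(4) by auto
    have "(m + 1) * E \<le> T * E" "(n + 1) * E \<le> T * E"
      by (intro mult_right_mono T le0)+
    moreover have "?init = 2 * ((m + 1) * E) + 2 * ((n + 1) * E) + 13 * E" by simp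
    ultimately have i: "?init \<le> 17 * (T * T * E)" using TE by linarith
    have "(m + n) * (3 + (E + (E + (2 * (m + n + 1) * E + 13 * E)))) \<le> T * (2 * T * E + 16 * E)"
      using T E_ge by (intro mult_mono) (auto simp: T_def)
    also have "\<dots> = 2 * (T * T * E) + 16 * (T * E)" by (simp add: algebra_simps)
    finally have ma: "?main \<le> 19 * (T * T * E)" using TE E_ge by linarith
    have "n * (1 + (E + 1)) \<le> T * (2 * E)" using T E_ge by (intro mult_mono) auto
    also have "\<dots> = 2 * (T * E)" by simp
    finally have o: "?out \<le> 4 * (T * T * E)" using TE E_ge by linarith
    have "?init + (?main + ?out) \<le> 60 * (T * T * E)" using i ma o by linarith
    also have "60 * (T * T * E) = 60 * (m + n + 1) ^ 2 * E"
      by (simp only: T_def power2_eq_square mult.assoc)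
    finally show "?init + (?main + ?out) \<le> 60 * (m + n + 1) ^ 2 * E" .
  qed simp
qed

end

section \<open>Heights of rational numbers\<close>

text \<open>The fraction need not be in lowest terms, so arithmetic can be bounded without greatest
  common divisors.\<close>

definition height_le :: "nat \<Rightarrow> real \<Rightarrow> bool" where
  "height_le k x \<longleftrightarrow> (\<exists>p q :: int. x = real_of_int p / real_of_int q \<and> 0 < q \<and>
     \<bar>p\<bar> \<le> 2 ^ k \<and> q \<le> 2 ^ k)"

lemma height_le_mono:
  assumes "height_le k x" "k \<le> l"
  shows "height_le l x"
proof -
  have "(2 :: int) ^ k \<le> 2 ^ l" using assms(2) by (intro power_increasing) auto
  moreover obtain p q where x: "x = real_of_int p / real_of_int q" "0 < q" "\<bar>p\<bar> \<le> 2 ^ k" "q \<le> 2 ^ k"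
    using assms(1) unfolding height_le_def by blast
  ultimately have "\<bar>p\<bar> \<le> 2 ^ l" "q \<le> 2 ^ l" by linarith+
  then show ?thesis unfolding height_le_def using x(1,2) by blast
qed

lemma height_le_0: "height_le k 0"
  unfolding height_le_def by (rule exI[of _ 0], rule exI[of _ 1]) simp

lemma height_le_1: "height_le k 1"
  unfolding height_le_def by (rule exI[of _ 1], rule exI[of _ 1]) simp

text \<open>Products of numerators and denominators are at most \<open>2 ^ (k + l)\<close>; the
  extra 1 pays for adding two of them in sums and differences.\<close>

lemma height_le_arith:
  assumes "height_le k x" "height_le l y"
  shows "height_le (k + l + 1) (apply_arith f x y)"
proof -
  obtain p q where x: "x = real_of_int p / real_of_int q" "0 < q" "\<bar>p\<bar> \<le> 2 ^ k" "q \<le> 2 ^ k"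
    using assms(1) unfolding height_le_def by blast
  obtain p' q' where y: "y = real_of_int p' / real_of_int q'" "0 < q'" "\<bar>p'\<bar> \<le> 2 ^ l" "q' \<le> 2 ^ l"
    using assms(2) unfolding height_le_def by blast
  have prod: "a * b \<le> 2 ^ k * 2 ^ l" if "0 \<le> a" "0 \<le> b" "a \<le> 2 ^ k" "b \<le> 2 ^ l" for a b :: int
    using that by (intro mult_mono) auto
  have le: "(2 :: int) ^ k * 2 ^ l \<le> 2 ^ (k + l + 1)" by (simp add: power_add)
  have two: "(2 :: int) ^ k * 2 ^ l + 2 ^ k * 2 ^ l = 2 ^ (k + l + 1)" by (simp add: power_add)
  have qq: "0 < q * q'" "q * q' \<le> 2 ^ (k + l + 1)"
    using x y prod[of q q'] le by auto
  have pq: "\<bar>p * q'\<bar> \<le> 2 ^ k * 2 ^ l" "\<bar>q * p'\<bar> \<le> 2 ^ k * 2 ^ l" "\<bar>p * p'\<bar> \<le> 2 ^ k * 2 ^ l"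
    using x y prod[of "\<bar>p\<bar>" q'] prod[of q "\<bar>p'\<bar>"] prod[of "\<bar>p\<bar>" "\<bar>p'\<bar>"] by (auto simp: abs_mult)
  have H: "height_le (k + l + 1) z"
    if "z = real_of_int a / real_of_int b" "0 < b" "\<bar>a\<bar> \<le> 2 ^ (k + l + 1)" "b \<le> 2 ^ (k + l + 1)"
    for z a b using that unfolding height_le_def by blast
  show ?thesis
  proof (cases f)
    case Add
    have "x + y = real_of_int (p * q' + q * p') / real_of_int (q * q')"
      using x(2) y(2) unfolding x(1) y(1) by (simp add: field_simps)
    moreover have "\<bar>p * q' + q * p'\<bar> \<le> 2 ^ (k + l + 1)" using pq two by linarith
    ultimately have "height_le (k + l + 1) (x + y)" by (rule H[OF _ qq(1) _ qq(2)])
    then show ?thesis using Add by simp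
  next
    case Sub
    have "x - y = real_of_int (p * q' - q * p') / real_of_int (q * q')"
      using x(2) y(2) unfolding x(1) y(1) by (simp add: field_simps)
    moreover have "\<bar>p * q' - q * p'\<bar> \<le> 2 ^ (k + l + 1)" using pq two by linarith
    ultimately have "height_le (k + l + 1) (x - y)" by (rule H[OF _ qq(1) _ qq(2)])
    then show ?thesis using Sub by simp
  next
    case Mul
    have "x * y = real_of_int (p * p') / real_of_int (q * q')"
      using x y by simp
    moreover have "\<bar>p * p'\<bar> \<le> 2 ^ (k + l + 1)" using pq le by linarith
    ultimately have "height_le (k + l + 1) (x * y)" by (rule H[OF _ qq(1) _ qq(2)])
    then show ?thesis using Mul by simp
  next
    case Div
    consider "p' = 0" | "0 < p'" | "p' < 0" by linarith
    then show ?thesis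
    proof cases
      case 1
      then show ?thesis using Div y height_le_0 by simp
    next
      case 2
      have "x / y = real_of_int (p * q') / real_of_int (q * p')"
        using x y by simp
      moreover have "0 < q * p'" using 2 x by simp
      moreover have "\<bar>p * q'\<bar> \<le> 2 ^ (k + l + 1)" "q * p' \<le> 2 ^ (k + l + 1)" using pq le by linarith+
      ultimately have "height_le (k + l + 1) (x / y)" by (rule H)
      then show ?thesis using Div by simp
    next
      case 3
      \<comment> \<open>The sign is moved to the numerator to keep the denominator positive.\<close>
      have "x / y = real_of_int (- (p * q')) / real_of_int (- (q * p'))"
        using x y by simp
      moreover have "0 < - (q * p')" using 3 x by (simp add: mult_pos_neg)
      moreover have "\<bar>- (p * q')\<bar> \<le> 2 ^ (k + l + 1)" "- (q * p') \<le> 2 ^ (k + l + 1)"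
        using pq le by linarith+
      ultimately have "height_le (k + l + 1) (x / y)" by (rule H)
      then show ?thesis using Div by simp
    qed
  qed
qed

lemma floorlog_le:
  assumes "0 \<le> a" "a \<le> 2 ^ k"
  shows "floorlog 2 (nat a) \<le> k + 1"
proof -
  have "a < 2 ^ (k + 1)" using assms(2) by (rule le_less_trans) simp
  then have "nat a < 2 ^ (k + 1)" using assms(1) by (simp add: nat_less_iff)
  then show ?thesis by (intro floorlog_leI) auto
qed

lemma bit_length_of_rat:
  "bit_length (real_of_rat r) =
     (let (p, q) = quotient_of r in 1 + floorlog 2 (nat \<bar>p\<bar>) + floorlog 2 (nat q))"
proof -
  have "(THE r'. real_of_rat r' = real_of_rat r) = r" by (rule the_equality) auto
  then show ?thesis by (simp add: bit_length_def)
qed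

text \<open>Reduction to lowest terms increases neither numerator nor denominator. Each is at most
  \<open>2 ^ k\<close>, which may take \<open>k + 1\<close> bits, and one more bit encodes the
  sign.\<close>

lemma bit_length_le:
  assumes "height_le k x"
  shows "bit_length x \<le> 2 * k + 3"
proof -
  obtain p q where x: "x = real_of_int p / real_of_int q" "0 < q" "\<bar>p\<bar> \<le> 2 ^ k" "q \<le> 2 ^ k"
    using assms unfolding height_le_def by blast
  obtain a b where ab: "quotient_of (Fract p q) = (a, b)" by (cases "quotient_of (Fract p q)")
  have b: "0 < b" "coprime a b" using quotient_of_denom_pos[OF ab] quotient_of_coprime[OF ab] by auto
  have "Fract p q = Fract a b" using quotient_of_div[OF ab] by (simp add: Fract_of_int_quotient)
  then have eq: "p * b = a * q" using x(2) b(1) by (simp add: eq_rat)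
  have "b dvd q" using b(2) eq by (metis coprime_commute coprime_dvd_mult_right_iff dvd_triv_right)
  then have bq: "b \<le> q" using x(2) by (rule zdvd_imp_le)
  have "\<bar>a\<bar> * b \<le> \<bar>a\<bar> * q" using bq by (intro mult_left_mono) auto
  also have "\<dots> = \<bar>p\<bar> * b" using eq x(2) b(1) by (metis abs_mult abs_of_pos)
  finally have "\<bar>a\<bar> \<le> \<bar>p\<bar>" using b(1) by simp
  then have "\<bar>a\<bar> \<le> 2 ^ k" "b \<le> 2 ^ k" using x bq by linarith+
  then have "floorlog 2 (nat \<bar>a\<bar>) \<le> k + 1" "floorlog 2 (nat b) \<le> k + 1"
    using floorlog_le[of "\<bar>a\<bar>" k] floorlog_le[of b k] b(1) by simp_all
  moreover have "x = real_of_rat (Fract p q)" using x by (simp add: Fract_of_int_quotient of_rat_divide)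
  ultimately show ?thesis by (simp add: bit_length_of_rat ab)
qed

lemma height_le_bit_length:
  assumes "x \<in> \<rat>"
  shows "height_le (bit_length x) x"
proof -
  obtain r where r: "x = real_of_rat r" using assms by (auto elim: Rats_cases)
  obtain p q where pq: "quotient_of r = (p, q)" by (cases "quotient_of r")
  have q: "0 < q" by (rule quotient_of_denom_pos[OF pq])
  have bl: "bit_length x = 1 + floorlog 2 (nat \<bar>p\<bar>) + floorlog 2 (nat q)"
    by (simp add: r bit_length_of_rat pq)
  have le: "int k \<le> 2 ^ l" if "floorlog 2 k \<le> l" for k l
  proof -
    have "k < 2 ^ l" using floorlog_leD[OF that] by simp
    then show ?thesis by (metis less_imp_le of_nat_less_iff of_nat_numeral of_nat_power)
  qed
  have "x = real_of_int p / real_of_int q"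
    using quotient_of_div[OF pq] by (simp add: r of_rat_divide)
  moreover have "\<bar>p\<bar> \<le> 2 ^ bit_length x" "q \<le> 2 ^ bit_length x"
    using le[of "nat \<bar>p\<bar>" "bit_length x"] le[of "nat q" "bit_length x"] q by (auto simp: bl)
  ultimately show ?thesis unfolding height_le_def using q by blast
qed

lemma bit_length_vec_ge: "i < dim_vec v \<Longrightarrow> bit_length (v $ i) \<le> bit_length_vec v"
  unfolding bit_length_vec_def by (rule member_le_sum) auto

lemma weight_uniform: "weight (\<lambda>_. 0) (\<lambda>_ _. True)"
  by unfold_locales auto

lemma weight_bit_length: "weight bit_length height_le"
  by unfold_locales
    (auto intro: height_le_mono height_le_0 height_le_1 height_le_arith bit_length_le)

section \<open>Separation\<close>

definition time_bound :: "nat poly" where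
  "time_bound = Polynomial.smult 1320 ([:2, 1:] ^ 5)"

lemma cost_le_time_bound:
  assumes "m + n \<le> N" "L \<le> N"
  shows "60 * (m + n + 1) ^ 2 * (6 * ((m + n + 2) * ((m + n + 1) * (2 * L + 2))) + 10)
    \<le> poly time_bound N"
proof -
  have "(m + n + 2) * ((m + n + 1) * (2 * L + 2)) \<le> (N + 2) * ((N + 2) * (2 * (N + 2)))"
    using assms by (intro mult_mono) auto
  also have "\<dots> = 2 * (N + 2) ^ 3" by (simp add: power3_eq_cube)
  finally have "6 * ((m + n + 2) * ((m + n + 1) * (2 * L + 2))) + 10 \<le> 12 * (N + 2) ^ 3 + 10"
    by simp
  also have "10 \<le> 10 * (N + 2) ^ 3" by simp
  then have "12 * (N + 2) ^ 3 + 10 \<le> 22 * (N + 2) ^ 3" by linarith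
  finally have "60 * (m + n + 1) ^ 2 * (6 * ((m + n + 2) * ((m + n + 1) * (2 * L + 2))) + 10)
      \<le> 60 * (N + 2) ^ 2 * (22 * (N + 2) ^ 3)"
    using assms by (intro mult_mono power_mono) auto
  also have "\<dots> = 1320 * ((N + 2) ^ 2 * (N + 2) ^ 3)" by simp
  also have "\<dots> = poly time_bound N"
    by (simp only: power_add[symmetric]) (simp add: time_bound_def poly_power add.commute)
  finally show ?thesis .
qed

context
  fixes D c y :: "real vec"
  assumes inst: "Qcmin_instance D c" and y: "y \<in> carrier_vec (dim_vec c)" "0\<^sub>v (dim_vec c) \<le> y"
begin

lemma array_of_vec_nonneg: "0 \<le> array_of_vec y j"
  using y(2) carrier_vecD[OF y(1)] by (simp add: array_of_vec_def less_eq_vec_def)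

text \<open>Generic in the weight, so that both cost models rest on one invariant; they differ only
  in the height bound \<open>L\<close> of the inputs.\<close>

lemma separation_program_correct:
  assumes "weight wt H" and H: "\<And>v i. v \<in> {D, c, y} \<Longrightarrow> i < dim_vec v \<Longrightarrow> H L (v $ i)"
    and N: "dim_vec D + dim_vec c \<le> N" "L \<le> N"
  shows "\<exists>s k. run wt separation_program (oracle_input D c y) k s \<and> k \<le> poly time_bound N \<and>
    correct_answer (dim_vec c) (P_ass D c) y (oracle_answer (dim_vec c) s)"
proof -
  let ?m = "dim_vec D" and ?n = "dim_vec c"
  interpret covering ?m ?n "($) D" "($) c" using Qcmin_covering[OF inst] .
  interpret weight wt H by fact
  have "H L (array_of_vec y j)" for j by (simp add: array_of_vec_def H H_0)
  then interpret separation_run ?m ?n "($) D" "($) c" wt H L "array_of_vec y"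
    by unfold_locales (auto intro: H array_of_vec_nonneg)
  have dim: "dim_vec y = ?n" using y by auto
  have mem_y: "y \<in> P_ass D c \<longleftrightarrow> fractional_cover (array_of_vec y)"
    using mem_P_ass_iff[OF inst, of y] y(1) fractional_cover_mono[of "($) y" "array_of_vec y"]
      fractional_cover_mono[of "array_of_vec y" "($) y"] by (auto simp: array_of_vec_def dim)
  have "terminates wt separation_program (oracle_input D c y) (60 * (?m + ?n + 1) ^ 2 * E) correct_output"
    by (rule terminates_separation_program)
      (auto simp: oracle_input_def array_of_vec_def fun_eq_iff)
  then obtain s k where run: "run wt separation_program (oracle_input D c y) k s"
    and k: "k \<le> 60 * (?m + ?n + 1) ^ 2 * E" and out: "correct_output s"
    unfolding terminates_def by blast
  have "k \<le> poly time_bound N"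
    using k cost_le_time_bound[OF N] unfolding E_def M_def X_def by (rule order_trans)
  moreover have "correct_answer ?n (P_ass D c) y (oracle_answer ?n s)"
  proof (cases "idx s 0 = 0")
    case True
    then show ?thesis using out by (simp add: oracle_answer_def correct_output_def mem_y)
  next
    case False
    then have sep: "separates (arr s 0) (arr s 1 0)" using out by (simp add: correct_output_def)
    let ?a = "vec ?n (arr s 0)"
    have prod: "?a \<bullet> x = (\<Sum>j<?n. arr s 0 j * x $ j)" if "dim_vec x = ?n" for x
      using that by (auto simp: scalar_prod_def atLeast0LessThan intro!: sum.cong)
    have "?a \<noteq> 0\<^sub>v ?n \<or> ?n = 0"
    proof (cases "?n = 0")
      case False
      then have pos: "0 < ?n" by (rule neq0_conv[THEN iffD1])
      then have "0 < arr s 0 0" using sep unfolding separates_def by blast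
      then have "?a $ 0 \<noteq> 0\<^sub>v ?n $ 0" unfolding index_vec[OF pos] index_zero_vec(1)[OF pos] by simp
      then show ?thesis by auto
    qed simp
    moreover have "?a \<bullet> y < arr s 1 0"
      using sep unfolding prod[OF dim] separates_def by (simp add: array_of_vec_def dim)
    moreover have "arr s 1 0 \<le> ?a \<bullet> x" if "x \<in> P_ass D c" for x
    proof -
      have x: "dim_vec x = ?n" "fractional_cover (($) x)"
        using that mem_P_ass_iff[OF inst] by auto
      then show ?thesis using sep unfolding prod[OF x(1)] separates_def by blast
    qed
    ultimately show ?thesis using False by (simp add: oracle_answer_def)
  qed
  ultimately show ?thesis using run by blast
qed

end

lemma exact_separation_oracle_P_ass:
  assumes inst: "Qcmin_instance D c"
  shows "exact_separation_oracle separation_program time_bound D c (P_ass D c)"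
  unfolding exact_separation_oracle_def
proof (intro ballI impI conjI)
  fix y :: "real vec" assume y: "y \<in> carrier_vec (dim_vec c)" "0\<^sub>v (dim_vec c) \<le> y"
  show "\<exists>s k. run (\<lambda>_. 0) separation_program (oracle_input D c y) k s \<and>
      k \<le> poly time_bound (dim_vec D + dim_vec c) \<and>
      correct_answer (dim_vec c) (P_ass D c) y (oracle_answer (dim_vec c) s)"
    \<comment> \<open>For uniform cost the height predicate is always true, so \<open>L = 0\<close>
      is allowed and the bound depends on \<open>m + n\<close> alone.\<close>
    by (rule separation_program_correct[OF inst y weight_uniform, where L = 0]) auto
  assume rat: "rational_vec D \<and> rational_vec c \<and> rational_vec y"
  let ?L = "bit_length_vec D + bit_length_vec c + bit_length_vec y"
  have "height_le ?L (v $ i)" if "v \<in> {D, c, y}" "i < dim_vec v" for v i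
  proof (rule height_le_mono)
    show "height_le (bit_length (v $ i)) (v $ i)"
      using that rat by (intro height_le_bit_length) (auto simp: rational_vec_def)
    show "bit_length (v $ i) \<le> ?L" using that bit_length_vec_ge[OF that(2)] by auto
  qed
  then have "\<exists>s k. run bit_length separation_program (oracle_input D c y) k s \<and>
      k \<le> poly time_bound (dim_vec D + dim_vec c + ?L) \<and>
      correct_answer (dim_vec c) (P_ass D c) y (oracle_answer (dim_vec c) s)"
    by (rule separation_program_correct[OF inst y weight_bit_length]) auto
  then show "\<exists>s k. run bit_length separation_program (oracle_input D c y) k s \<and>
      k \<le> poly time_bound (dim_vec D + dim_vec c + bit_length_vec D + bit_length_vec c +
        bit_length_vec y)"
    by (auto simp: add.assoc)
qed

theorem theorem9:
  shows "\<exists>(prog :: com) (p :: nat poly). \<forall>D c. Qcmin_instance D c \<longrightarrow>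
     approx_supply_polyhedron 2 D c (P_ass D c) \<and>
     upward_feasible c (P_ass D c) \<and>
     exact_separation_oracle prog p D c (P_ass D c)"
  using approx_supply_polyhedron_P_ass upward_feasible_P_ass exact_separation_oracle_P_ass by blast

end
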